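(* Let $m,n\in\mathbb{N}_0$, let $\alpha,\beta>-1$ be such that if $\alpha,\beta\in(-1,0)$ then $\alpha+\beta+1\neq0$, and let $\rho\in(0,1)$. With $R=\sqrt{1+\rho^2-2\rho x}$ and $\zeta_-=(1-\rho)/R$, $$\int_{-1}^1\frac{(1-x)^{\alpha/2}(1+x)^{\beta}}{R^{\beta+m+1}}\,\mathrm{P}_{\beta+m}^{-\alpha}(\zeta_-)\,P_n^{(\alpha,\beta)}(x)\,dx=\frac{2^{\alpha/2+\beta+1}\,\Gamma(\beta+n+1)\,(\alpha+\beta+m+1)_{2n}}{n!\,\rho^{(\beta+1)/2}(1+\rho)^m}\,\mathrm{P}_{-m}^{-\alpha-\beta-2n-1}\!\left(\frac{1-\rho}{1+\rho}\right).$$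
   Context: $\mathbb{N}_0=\{0,1,2,\dots\}$. $(z)_n=\prod_{i=1}^n(z+i-1)$ is the Pochhammer symbol. ${}_2F_1$ is the Gauss hypergeometric function, analytically continued to $\mathbb{C}\setminus[1,\infty)$. The Jacobi polynomials are $P_n^{(\alpha,\beta)}(z)=\frac{(\alpha+1)_n}{n!}\,{}_2F_1(-n,n+\alpha+\beta+1;\alpha+1;\frac{1-z}{2})$. The Ferrers function of the first kind (roman $\mathrm{P}$) on $(-1,1)$ is $\mathrm{P}_\nu^\mu(x)=\frac{1}{\Gamma(1-\mu)}\left(\frac{1+x}{1-x}\right)^{\mu/2}{}_2F_1(-\nu,\nu+1;1-\mu;\frac{1-x}{2})$. *)

theory Defs
  imports "HOL-Analysis.Analysis"
begin

definition gauss_fps :: "complex \<Rightarrow> complex \<Rightarrow> complex \<Rightarrow> complex fps" where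
  "gauss_fps a b c = fps_hypergeo [a, b] [c] 1"

lemma gauss_fps_nth:
  "fps_nth (gauss_fps a b c) k =
     pochhammer a k * pochhammer b k / (pochhammer c k * fact k)"
  by (simp add: gauss_fps_def)

(* Meaningful for c not in {0, -1, -2, ...}.  The first branch covers the disc of convergence and,
   for all z, the terminating series (so that Jacobi polynomials are polynomials on the whole
   plane).  The second branch is the value at z of the holomorphic continuation of the series to
   the plane cut along [1, \<infinity>), which is unique since the cut plane is connected; on the cut
   itself its value carries no meaning. *)
definition hyp2F1 :: "complex \<Rightarrow> complex \<Rightarrow> complex \<Rightarrow> complex \<Rightarrow> complex" where
  "hyp2F1 a b c z =
     (if norm z < 1 \<or> a \<in> \<int>\<^sub>\<le>\<^sub>0 \<or> b \<in> \<int>\<^sub>\<le>\<^sub>0 then eval_fps (gauss_fps a b c) z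
      else (THE w. \<exists>F. F holomorphic_on (- complex_of_real ` {1..}) \<and>
                       (\<forall>u. norm u < 1 \<longrightarrow> F u = eval_fps (gauss_fps a b c) u) \<and>
                       F z = w))"

definition jacobi_P :: "nat \<Rightarrow> complex \<Rightarrow> complex \<Rightarrow> complex \<Rightarrow> complex" where
  "jacobi_P n \<alpha> \<beta> z =
     pochhammer (\<alpha> + 1) n / fact n *
     hyp2F1 (- of_nat n) (of_nat n + \<alpha> + \<beta> + 1) (\<alpha> + 1) ((1 - z) / 2)"

(* For x in (-1, 1); the order of the arguments is degree, order, variable. *)
definition ferrers_P :: "complex \<Rightarrow> complex \<Rightarrow> real \<Rightarrow> complex" where
  "ferrers_P \<nu> \<mu> x =
     1 / Gamma (1 - \<mu>) * complex_of_real ((1 + x) / (1 - x)) powr (\<mu> / 2) *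
     hyp2F1 (- \<nu>) (\<nu> + 1) (1 - \<mu>) (complex_of_real ((1 - x) / 2))"

end

theory Submission
  imports Defs "HOL-Complex_Analysis.Complex_Analysis"
begin

text \<open>
Put $y = (1-x)/2$, $c = \<alpha>+1$ and $s = \<alpha>+\<beta>+m+1$. Up to the weight $(1-x)^{\<alpha>/2}$ and constants,
the Ferrers function on the left, divided by $R^{\<beta>+m+1}$, is the generating function of
Jacobi polynomials
\[ (1+u)^{-s}\,{}_2F_1(\frac s2, \frac{s+1}2; c; \frac{4yu}{(1+u)^2}) = \sum_N Q_N(y) u^N, \]
at $u = -\<rho>$, where $Q_N$ is a multiple of the Jacobi polynomial with parameters $\<alpha>$ and $\<beta>+m$.
So the integral can be computed term by term: the integral of $Q_N$ against the weight and
$P_n^{(\<alpha>,\<beta>)}$ vanishes for $N < n$ by orthogonality and has a closed form for $N \<ge> n$. The resulting power series is a multiple of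
$\<rho>^n\,{}_2F_1(s+2n, m; \<alpha>+\<beta>+2n+2; -\<rho>)$, and Pfaff's transformation turns it into the Ferrers
function on the right.

Two points need care. First, the identity between the Ferrers function and the power
series must hold for all $\<rho>$ in $(0,1)$, not only for small ones. The quadratic transformation
of ${}_2F_1$ provides a form of the generating function that is visibly holomorphic for
$|u| < 1$ (\<open>gen_fun\<close>), so that its Taylor series converges there
(\<open>gen_coeff_sums\<close>); that this form is the Ferrers kernel is
\<open>ferrers_kernel_eq_gen_fun\<close>. Second, integration term by term needs a bound on
$Q_N(y)$ uniform in $y$; Cauchy's inequality and compactness give one that is geometric
(\<open>gen_coeff_bound\<close>). Pfaff's and the quadratic transformation are proved coefficientwise as formal power series,
where both reduce to the Chu--Vandermonde summation, and are then extended from a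
neighbourhood of $0$ by analytic continuation.
\<close>

section \<open>Gauss series and their power series identities\<close>

lemma pochhammer_neg_nat_eq:
  assumes "k \<le> n"
  shows "pochhammer (- of_nat n :: 'a::field_char_0) k = (-1) ^ k * fact n / fact (n - k)"
proof -
  have "(fact n :: 'a) = fact (n - k) * pochhammer (of_nat n - of_nat k + 1) k"
    using pochhammer_product[of "n - k" n "1 :: 'a"] assms
    by (simp add: pochhammer_fact of_nat_diff algebra_simps)
  then show ?thesis
    by (simp add: pochhammer_minus)
qed

text \<open>The Chu--Vandermonde summation of a terminating ${}_2F_1$ at $1$, with the factor
$(-N)_k$ resolved into factorials. Coefficient extraction below always produces sums of
this shape.\<close>

lemma Chu_Vandermonde_fact:
  fixes a c :: "'a::field_char_0"
  assumes c: "c \<notin> \<int>\<^sub>\<le>\<^sub>0"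
  shows "(\<Sum>k\<le>N. (-1) ^ k * pochhammer a k / (pochhammer c k * fact k * fact (N - k)))
           = pochhammer (c - a) N / (pochhammer c N * fact N)"
proof -
  have *: "(-1) ^ k * pochhammer a k / (pochhammer c k * fact k * fact (N - k)) =
        (pochhammer a k * pochhammer (- of_nat N) k / (of_nat (fact k) * pochhammer c k)) / fact N"
    if "k \<le> N" for k
  proof -
    have "pochhammer (- of_nat N) k / fact N = (-1) ^ k / (fact (N - k) :: 'a)"
      using that by (simp add: pochhammer_neg_nat_eq)
    then show ?thesis
      by (metis (no_types, lifting) mult.commute of_nat_fact times_divide_eq_right
          divide_divide_eq_left' mult.left_commute mult.assoc)
  qed
  have "\<forall>i\<in>{0..<N}. c \<noteq> - of_nat i"
    using c by auto
  from Vandermonde_pochhammer[OF this, of a] show ?thesis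
    using * by (simp add: atMost_atLeast0 sum_divide_distrib[symmetric] flip: divide_divide_eq_left)
qed

lemma fps_conv_radius_gauss:
  assumes c: "c \<notin> \<int>\<^sub>\<le>\<^sub>0"
  shows "fps_conv_radius (gauss_fps a b c) \<ge> 1"
proof (cases "a \<in> \<int>\<^sub>\<le>\<^sub>0 \<or> b \<in> \<int>\<^sub>\<le>\<^sub>0")
  case True
  then obtain n where n: "a = - of_nat n \<or> b = - of_nat n"
    by (auto elim!: nonpos_Ints_cases')
  have "fps_nth (gauss_fps a b c) k = 0" if "k > n" for k
    using n that by (auto simp: gauss_fps_nth pochhammer_of_nat_eq_0_lemma)
  then have "\<forall>\<^sub>F k in sequentially. fps_nth (gauss_fps a b c) k = 0"
    by (intro eventually_sequentiallyI[of "Suc n"]) auto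
  then have "conv_radius (fps_nth (gauss_fps a b c)) = conv_radius (\<lambda>_. 0 :: complex)"
    by (intro conv_radius_cong') auto
  then show ?thesis
    by (simp add: fps_conv_radius_def)
next
  case False
  let ?f = "fps_nth (gauss_fps a b c)"
  have nz: "pochhammer x k \<noteq> 0" if "x \<notin> \<int>\<^sub>\<le>\<^sub>0" for x :: complex and k
    using that pochhammer_eq_0_imp_nonpos_Int by blast
  have nz': "x + of_nat k \<noteq> 0" if "x \<notin> \<int>\<^sub>\<le>\<^sub>0" for x :: complex and k
    using that by (auto simp: add_eq_0_iff2)
  have ratio: "norm (?f k) / norm (?f (Suc k)) =
      norm ((c + of_nat k) * (1 + of_nat k) / ((a + of_nat k) * (b + of_nat k)))" for k
    using nz[OF c, of k] nz[of a k] nz[of b k] nz'[of a k] nz'[of b k] nz'[OF c, of k] False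
    by (simp add: gauss_fps_nth pochhammer_Suc norm_divide [symmetric] divide_simps)
  have "(\<lambda>k. (c + of_nat k) * (1 + of_nat k) / ((a + of_nat k) * (b + of_nat k))) \<longlonglongrightarrow> 1"
  proof -
    have lim: "(\<lambda>k. x / of_nat k) \<longlonglongrightarrow> 0" for x :: complex
      using tendsto_mult[OF tendsto_const lim_inverse_n, of x] by (simp add: divide_inverse)
    have "(\<lambda>k. (c / of_nat k + 1) * (1 / of_nat k + 1) / ((a / of_nat k + 1) * (b / of_nat k + 1)))
            \<longlonglongrightarrow> (0 + 1) * (0 + 1) / ((0 + 1) * (0 + 1))"
      by (intro tendsto_intros lim) auto
    moreover have "\<forall>\<^sub>F k in sequentially.
        (c / of_nat k + 1) * (1 / of_nat k + 1) / ((a / of_nat k + 1) * (b / of_nat k + 1)) =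
        (c + of_nat k) * (1 + of_nat k) / ((a + of_nat k) * (b + of_nat k))"
      using eventually_gt_at_top[of 0]
    proof eventually_elim
      case (elim k)
      have *: "x / of_nat k + 1 = (x + of_nat k) / of_nat k" for x :: complex
        using elim by (simp add: field_simps)
      show ?case
        unfolding * using elim by simp
    qed
    ultimately show ?thesis
      by (simp add: tendsto_cong)
  qed
  then have "(\<lambda>k. norm (?f k) / norm (?f (Suc k))) \<longlonglongrightarrow> norm (1 :: complex)"
    unfolding ratio by (rule tendsto_norm)
  then have "conv_radius ?f = 1"
    by (intro conv_radius_ratio_limit_nonzero[where c = 1]) (auto simp: one_ereal_def)
  then show ?thesis
    by (simp add: fps_conv_radius_def)
qed

lemma fps_conv_radius_gauss_pos:
  "c \<notin> \<int>\<^sub>\<le>\<^sub>0 \<Longrightarrow> fps_conv_radius (gauss_fps a b c) > 0"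
  by (rule less_le_trans[OF _ fps_conv_radius_gauss]) simp_all

lemma ball_subset_eball_gauss:
  "c \<notin> \<int>\<^sub>\<le>\<^sub>0 \<Longrightarrow> norm z < 1 \<Longrightarrow> z \<in> eball 0 (fps_conv_radius (gauss_fps a b c))"
  using fps_conv_radius_gauss[of c a b] by (auto simp: one_ereal_def intro: less_le_trans[of _ "ereal 1"])

text \<open>The transformations of ${}_2F_1$ used below all involve
$(1+u)^{-d} A(t u/(1+u)^j)$ with $j = 1$ (Pfaff) or $j = 2$ (quadratic). Expanding formally,
as the composition of $A$ with a multiple of $u (1+u)^{-j}$, reduces each of them to a
finite identity per coefficient and needs no rearrangement of double series.\<close>

lemma has_fps_expansion_substitution:
  fixes A :: "complex fps" and d t :: complex and j :: nat
  assumes A: "fps_conv_radius A > 0"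
  shows "(\<lambda>u. (1 + u) powr (- d) * eval_fps A (t * u / (1 + u) ^ j)) has_fps_expansion
           Abs_fps (\<lambda>N. \<Sum>k\<le>N. fps_nth A k * t ^ k * (-1) ^ (N - k) *
              pochhammer (d + of_nat (j * k)) (N - k) / fact (N - k))"
    (is "?f has_fps_expansion ?F")
proof -
  define G where "G = fps_const t * fps_X * fps_binomial (- of_nat j)"
  let ?g = "\<lambda>u::complex. t * u * (1 + u) powr (- of_nat j)"
  have g: "?g has_fps_expansion G"
    unfolding G_def by (intro fps_expansion_intros)
  have 1: "(\<lambda>u. (eval_fps A \<circ> ?g) u * (1 + u) powr (- d)) has_fps_expansion
          fps_compose A G * fps_binomial (- d)"
    by (intro fps_expansion_intros eval_fps_has_fps_expansion A g) (simp_all add: G_def)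
  have 2: "\<forall>\<^sub>F u in nhds 0. (eval_fps A \<circ> ?g) u * (1 + u) powr (- d) = ?f u"
  proof -
    have "\<forall>\<^sub>F u in nhds (0::complex). u \<in> - {-1}"
      by (intro eventually_nhds_in_open) auto
    then show ?thesis
    proof eventually_elim
      case (elim u)
      then have "1 + u \<noteq> 0"
        by (auto simp: add_eq_0_iff)
      then show ?case
        by (simp add: powr_minus powr_nat' field_simps)
    qed
  qed
  have 3: "fps_compose A G * fps_binomial (- d) = ?F"
  proof (rule fps_ext)
    fix N
    have Gpow: "G ^ k = fps_const (t ^ k) * (fps_X ^ k * fps_binomial (- of_nat (j * k)))" for k
      by (simp add: G_def power_mult_distrib fps_binomial_power fps_const_power mult_ac)
    have pow: "G ^ k * fps_binomial (- d) =
        fps_const (t ^ k) * (fps_X ^ k * fps_binomial (- d - of_nat (j * k)))" for k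
      using fps_binomial_add_mult[of "- d" "- of_nat (j * k)"] by (simp add: Gpow mult_ac)
    have "fps_nth (fps_compose A G * fps_binomial (- d)) N =
        (\<Sum>i\<le>N. (\<Sum>k\<le>N. fps_nth A k * fps_nth (G ^ k) i) * fps_nth (fps_binomial (- d)) (N - i))"
      unfolding fps_mult_nth atLeast0AtMost
    proof (intro sum.cong refl arg_cong2[of _ _ _ _ "(*)"])
      fix i assume "i \<in> {..N}"
      then show "fps_nth (fps_compose A G) i = (\<Sum>k\<le>N. fps_nth A k * fps_nth (G ^ k) i)"
        unfolding fps_compose_nth
        by (intro sum.mono_neutral_left) (auto simp: Gpow fps_X_power_mult_nth)
    qed
    also have "\<dots> = (\<Sum>k\<le>N. fps_nth A k * fps_nth (G ^ k * fps_binomial (- d)) N)"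
      unfolding fps_mult_nth atLeast0AtMost sum_distrib_left sum_distrib_right
      by (subst sum.swap) (simp add: mult_ac)
    also have "\<dots> = fps_nth ?F N"
      unfolding pow fps_nth_Abs_fps
      by (intro sum.cong refl)
         (simp add: fps_X_power_mult_nth gbinomial_pochhammer add.commute)
    finally show "fps_nth (fps_compose A G * fps_binomial (- d)) N = fps_nth ?F N" .
  qed
  show ?thesis
    using has_fps_expansion_cong[OF 2 3] 1 by blast
qed

lemma has_fps_expansion_reflect:
  fixes A :: "complex fps"
  assumes "fps_conv_radius A > 0"
  shows "(\<lambda>u. eval_fps A (- u)) has_fps_expansion Abs_fps (\<lambda>N. (-1) ^ N * fps_nth A N)"
proof (rule has_fps_expansionI)
  have "\<forall>\<^sub>F u in nhds 0. u \<in> eball 0 (fps_conv_radius A)"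
    using assms by (intro eventually_nhds_in_open) (auto simp: zero_ereal_def)
  then show "\<forall>\<^sub>F u in nhds 0. (\<lambda>N. fps_nth (Abs_fps (\<lambda>N. (-1) ^ N * fps_nth A N)) N * u ^ N)
                 sums eval_fps A (- u)"
  proof eventually_elim
    case (elim u)
    then show ?case
      using sums_eval_fps[of "- u" A] by (simp add: power_minus[of u] mult_ac)
  qed
qed

text \<open>The coefficients of the two sides agree by Chu--Vandermonde, so the sides agree near $0$.
Both are holomorphic on the part of the unit disc where $|u/(1+u)| < 1$, that is where
$\mathrm{Re}\,u > -1/2$; this region is convex, and the identity theorem finishes the proof.
The sign is chosen such that $u = \rho$ can later be inserted directly.\<close>

lemma eval_gauss_Pfaff:
  fixes a b c u :: complex
  assumes c: "c \<notin> \<int>\<^sub>\<le>\<^sub>0" and u: "norm u < 1" "Re u > - 1 / 2"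
  shows "eval_fps (gauss_fps a b c) (- u) =
           (1 + u) powr (- b) * eval_fps (gauss_fps (c - a) b c) (u / (1 + u))"
proof -
  define S :: "complex set" where "S = ball 0 1 \<inter> {z. Re z > - 1 / 2}"
  let ?f = "\<lambda>u. eval_fps (gauss_fps a b c) (- u)"
  let ?g = "\<lambda>u. (1 + u) powr (- b) * eval_fps (gauss_fps (c - a) b c) (u / (1 + u))"
  note R = fps_conv_radius_gauss_pos[OF c] and eball = ball_subset_eball_gauss[OF c]
  have "?f has_fps_expansion Abs_fps (\<lambda>N. (-1) ^ N * fps_nth (gauss_fps a b c) N)"
    by (rule has_fps_expansion_reflect) (rule R)
  moreover have "?g has_fps_expansion Abs_fps (\<lambda>N. (-1) ^ N * fps_nth (gauss_fps a b c) N)"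
  proof -
    have "(\<Sum>k\<le>N. fps_nth (gauss_fps (c - a) b c) k * 1 ^ k * (- 1) ^ (N - k) *
             pochhammer (b + of_nat (1 * k)) (N - k) / fact (N - k)) =
          (-1) ^ N * fps_nth (gauss_fps a b c) N" for N
    proof -
      have "(\<Sum>k\<le>N. fps_nth (gauss_fps (c - a) b c) k * 1 ^ k * (- 1) ^ (N - k) *
               pochhammer (b + of_nat (1 * k)) (N - k) / fact (N - k)) =
            (\<Sum>k\<le>N. (-1) ^ N * pochhammer b N *
               ((-1) ^ k * pochhammer (c - a) k / (pochhammer c k * fact k * fact (N - k))))"
      proof (intro sum.cong refl)
        fix k assume "k \<in> {..N}"
        then have k: "k \<le> N" by simp
        have "(-1) ^ (N - k) = (-1) ^ N * ((-1) ^ k :: complex)"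
          using k by (simp add: uminus_power_if)
        then show "fps_nth (gauss_fps (c - a) b c) k * 1 ^ k * (- 1) ^ (N - k) *
               pochhammer (b + of_nat (1 * k)) (N - k) / fact (N - k) =
             (-1) ^ N * pochhammer b N *
               ((-1) ^ k * pochhammer (c - a) k / (pochhammer c k * fact k * fact (N - k)))"
          by (simp add: gauss_fps_nth pochhammer_product[OF k, of b])
      qed
      also have "\<dots> = (-1) ^ N * pochhammer b N * (pochhammer a N / (pochhammer c N * fact N))"
        unfolding sum_distrib_left[symmetric] by (simp add: Chu_Vandermonde_fact[OF c])
      finally show ?thesis
        by (simp add: gauss_fps_nth)
    qed
    with has_fps_expansion_substitution[OF R, of b "c - a" b 1 1] show ?thesis
      by simp
  qed
  ultimately have "(\<lambda>u. ?f u - ?g u) has_fps_expansion 0"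
    using has_fps_expansion_diff by fastforce
  moreover have "(\<lambda>u. ?f u - ?g u) holomorphic_on S"
  proof -
    have nz: "1 + z \<noteq> 0" "1 + z \<notin> \<real>\<^sub>\<le>\<^sub>0" if "z \<in> S" for z
      using that by (auto simp: S_def complex_eq_iff complex_nonpos_Reals_iff)
    have lt: "norm (z / (1 + z)) < 1" if "z \<in> S" for z
    proof -
      have "(norm z)\<^sup>2 < (norm (1 + z))\<^sup>2"
        unfolding cmod_power2 using that by (simp add: S_def power2_sum)
      then have "norm z < norm (1 + z)"
        by (rule power_less_imp_less_base) simp
      then show ?thesis
        using nz[OF that] by (simp add: norm_divide)
    qed
    have h: "uminus holomorphic_on S"
      by (intro holomorphic_intros)
    have 1: "?f holomorphic_on S"
      by (rule holomorphic_on_compose_gen[OF h holomorphic_on_eval_fps, unfolded o_def, OF subset_refl])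
         (auto simp: S_def intro!: eball simp del: in_eball_iff)
    have h: "(\<lambda>z. z / (1 + z)) holomorphic_on S"
      by (intro holomorphic_intros) (auto dest: nz)
    have 2: "(\<lambda>z. eval_fps (gauss_fps (c - a) b c) (z / (1 + z))) holomorphic_on S"
      by (rule holomorphic_on_compose_gen[OF h holomorphic_on_eval_fps, unfolded o_def, OF subset_refl])
         (auto intro!: eball lt simp del: in_eball_iff)
    show ?thesis
      by (intro holomorphic_intros 1 2) (auto dest: nz)
  qed
  moreover have "open S" "connected S"
    unfolding S_def
    by (auto intro!: open_Int open_halfspace_Re_gt convex_connected convex_Int convex_halfspace_Re_gt)
  ultimately have "?f u - ?g u = 0"
    by (rule has_fps_expansion_0_analytic_continuation) (use u in \<open>auto simp: S_def\<close>)
  then show ?thesis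
    by simp
qed

text \<open>Up to normalisation this is a Jacobi polynomial in the variable $1 - 2y$:
it equals $(-1)^N \frac{(s)_N}{N!}\,{}_2F_1(-N, s+N; c; y)$, the coefficient of $u^N$ in
the classical generating function
$(1+u)^{-s}\,{}_2F_1(\frac s2, \frac{s+1}2; c; \frac{4yu}{(1+u)^2})$.\<close>

definition gen_coeff :: "'a::field_char_0 \<Rightarrow> 'a \<Rightarrow> nat \<Rightarrow> 'a \<Rightarrow> 'a" where
  "gen_coeff s c N y =
     (\<Sum>k\<le>N. (-1) ^ (N + k) * pochhammer s (N + k) * y ^ k /
        (pochhammer c k * fact k * fact (N - k)))"

lemma quadratic_has_fps_expansion:
  assumes c: "c \<notin> \<int>\<^sub>\<le>\<^sub>0"
  shows "(\<lambda>u. (1 + u) powr (- s) *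
            eval_fps (gauss_fps (s / 2) ((s + 1) / 2) c) (4 * y * u / (1 + u)\<^sup>2))
          has_fps_expansion Abs_fps (\<lambda>N. gen_coeff s c N y)"
proof -
  note fps_conv_radius_gauss_pos[OF c]
  moreover
  have "fps_nth (gauss_fps (s / 2) ((s + 1) / 2) c) k * (4 * y) ^ k * (- 1) ^ (N - k) *
      pochhammer (s + of_nat (2 * k)) (N - k) / fact (N - k) =
      (-1) ^ (N + k) * pochhammer s (N + k) * y ^ k / (pochhammer c k * fact k * fact (N - k))"
    if k: "k \<le> N" for N k
  proof -
    have "pochhammer s (N + k) = pochhammer s (2 * k) * pochhammer (s + of_nat (2 * k)) (N - k)"
      using pochhammer_product[of "2 * k" "N + k" s] k by simp
    also have "pochhammer s (2 * k) = 4 ^ k * pochhammer (s / 2) k * pochhammer ((s + 1) / 2) k"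
      using pochhammer_double[of "s / 2" k] by (simp add: power_mult add_divide_distrib)
    finally have "pochhammer s (N + k) =
      4 ^ k * pochhammer (s / 2) k * pochhammer ((s + 1) / 2) k * pochhammer (s + of_nat (2 * k)) (N - k)" .
    moreover have "(-1) ^ (N - k) = ((-1) ^ (N + k) :: complex)"
      using k by (simp add: uminus_power_if)
    ultimately show ?thesis
      by (simp add: gauss_fps_nth power_mult_distrib)
  qed
  then have "(\<Sum>k\<le>N. fps_nth (gauss_fps (s / 2) ((s + 1) / 2) c) k * (4 * y) ^ k * (- 1) ^ (N - k) *
      pochhammer (s + of_nat (2 * k)) (N - k) / fact (N - k)) = gen_coeff s c N y" for N
    unfolding gen_coeff_def by (intro sum.cong refl) (simp only: atMost_iff)
  ultimately show ?thesis
    using has_fps_expansion_substitution[of "gauss_fps (s / 2) ((s + 1) / 2) c" s "4 * y" 2]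
    by simp
qed

text \<open>At $y = 1$ the coefficient has a closed form, again by Chu--Vandermonde. The identity is used
twice: it is the quadratic transformation of ${}_2F_1$, and it sums the integrated
generating series at the end.\<close>

lemma gen_coeff_1:
  assumes c: "c \<notin> \<int>\<^sub>\<le>\<^sub>0"
  shows "gen_coeff s c N 1 = pochhammer s N * pochhammer (s - c + 1) N / (pochhammer c N * fact N)"
proof -
  have "gen_coeff s c N 1 = (\<Sum>k\<le>N. (-1) ^ N * pochhammer s N *
      ((-1) ^ k * pochhammer (s + of_nat N) k / (pochhammer c k * fact k * fact (N - k))))"
    unfolding gen_coeff_def by (intro sum.cong refl) (simp add: pochhammer_product' power_add)
  also have "\<dots> = (-1) ^ N * pochhammer s N *
      (pochhammer (c - (s + of_nat N)) N / (pochhammer c N * fact N))"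
    unfolding sum_distrib_left[symmetric] by (simp add: Chu_Vandermonde_fact[OF c])
  also have "pochhammer (c - (s + of_nat N)) N = (-1) ^ N * pochhammer (s - c + 1) N"
    using pochhammer_minus'[of "c - s - 1" N] by (simp add: algebra_simps)
  finally show ?thesis
    by (simp flip: power_mult_distrib)
qed

corollary gen_coeff_1_gauss:
  "c \<notin> \<int>\<^sub>\<le>\<^sub>0 \<Longrightarrow> gen_coeff s c N 1 = fps_nth (gauss_fps s (s - c + 1) c) N"
  by (simp add: gen_coeff_1 gauss_fps_nth)

lemma gen_coeff_of_real:
  "gen_coeff (of_real s) (of_real c) N (of_real y) = (of_real (gen_coeff s c N y) :: 'a::real_normed_field)"
  by (simp add: gen_coeff_def pochhammer_of_real)

section \<open>The generating function on the whole unit disc\<close>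

text \<open>The series for ${}_2F_1(\frac s2, \frac{s+1}2; c; \cdot)$ converges only for arguments in the
unit disc, whereas $\frac{4yu}{(1+u)^2}$ leaves it already for moderate $u$. The
substitution $\frac{4w}{(1+w)^2} = \frac{4yu}{(1+u)^2}$ with $|w| < 1$ repairs this: the
quadratic transformation turns the factor into ${}_2F_1(s, s-c+1; c; w)$, whose series
converges for all $u$ in the unit disc. Here $w$ is \<open>quad_var\<close>.\<close>

definition quad_root :: "real \<Rightarrow> complex \<Rightarrow> complex" where
  "quad_root y u = csqrt (1 - 4 * of_real y * u / (1 + u)\<^sup>2)"

definition quad_var :: "real \<Rightarrow> complex \<Rightarrow> complex" where
  "quad_var y u = (1 - quad_root y u) / (1 + quad_root y u)"

definition gen_fun :: "complex \<Rightarrow> complex \<Rightarrow> real \<Rightarrow> complex \<Rightarrow> complex" where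
  "gen_fun s c y u = (1 + u) powr (- s) * (1 + quad_var y u) powr s *
     eval_fps (gauss_fps s (s - c + 1) c) (quad_var y u)"

text \<open>The Koebe function $u/(1+u)^2$ maps the unit disc onto the plane slit along $[1/4, \<infinity>)$,
and multiplication with $4y$, $0 \<le> y \<le> 1$, keeps the values off $[1, \<infinity>)$. Concretely, a
nonpositive real value makes $u$ a root of $u^2 - 2eu + 1$ for a real $e$ with $|e| \<le> 1$,
and such roots lie on the unit circle.\<close>

lemma quad_radicand_not_nonpos:
  fixes u :: complex and y :: real
  assumes u: "norm u < 1" and y: "0 \<le> y" "y \<le> 1"
  shows "1 - 4 * of_real y * u / (1 + u)\<^sup>2 \<notin> \<real>\<^sub>\<le>\<^sub>0"
proof
  assume "1 - 4 * of_real y * u / (1 + u)\<^sup>2 \<in> \<real>\<^sub>\<le>\<^sub>0"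
  then obtain t where t: "t \<le> 0" "1 - 4 * of_real y * u / (1 + u)\<^sup>2 = of_real t"
    by (auto elim!: nonpos_Reals_cases)
  have nz: "1 + u \<noteq> 0"
    using u by (auto simp: add_eq_0_iff)
  \<comment> \<open>chosen such that clearing denominators gives \<open>1 + u\<^sup>2 = 2 * e * u\<close>\<close>
  define e where "e = 2 * y / (1 - t) - 1"
  have e: "\<bar>e\<bar> \<le> 1"
    using t(1) y by (auto simp: e_def abs_le_iff divide_simps)
  have "of_real (1 - t) * (1 + u)\<^sup>2 = 4 * of_real y * u"
    using t(2) nz by (simp add: field_simps)
  moreover have "of_real (1 - t) * (2 * of_real (e + 1)) = (4 * of_real y :: complex)"
  proof -
    have "(1 - t) * (2 * (e + 1)) = 4 * y"
      using t(1) by (simp add: e_def field_simps)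
    then show ?thesis
      by (metis of_real_mult of_real_numeral)
  qed
  ultimately have "of_real (1 - t) * (1 + u)\<^sup>2 = of_real (1 - t) * (2 * of_real (e + 1)) * u"
    by simp
  moreover have "(of_real (1 - t) :: complex) \<noteq> 0"
    using t(1) by (simp only: of_real_eq_0_iff)
  ultimately have "(1 + u)\<^sup>2 = 2 * of_real (e + 1) * u"
    by (metis (no_types, lifting) mult.assoc mult_left_cancel)
  then have eq: "1 + u\<^sup>2 = 2 * of_real e * u"
    by (simp add: power2_eq_square algebra_simps)
  define a b where "a = Re u" and "b = Im u"
  have re: "1 + a\<^sup>2 - b\<^sup>2 = 2 * e * a" and im: "a * b = e * b"
    using arg_cong[OF eq, of Re] arg_cong[OF eq, of Im]
    by (simp_all add: a_def b_def power2_eq_square)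
  have lt: "a\<^sup>2 + b\<^sup>2 < 1"
    using u by (simp add: a_def b_def flip: cmod_power2) (simp add: power_less_one_iff abs_square_less_1)
  show False
  proof (cases "b = 0")
    case False
    then show False using re im lt by (simp add: power2_eq_square)
  next
    case True
    have "e * a \<le> \<bar>a\<bar>"
      using e by (metis abs_ge_self abs_ge_zero abs_mult mult_left_le_one_le order_trans)
    then have "(\<bar>a\<bar> - 1)\<^sup>2 \<le> 0"
      using re True by (simp add: power2_diff)
    then have "a\<^sup>2 = 1" by (simp add: abs_square_eq_1)
    then show False using lt True by simp
  qed
qed

context
  fixes u :: complex and y :: real
  assumes u: "norm u < 1" and y: "0 \<le> y" "y \<le> 1"
begin

lemma Re_quad_root_pos: "Re (quad_root y u) > 0"
proof -
  let ?v = "1 - 4 * of_real y * u / (1 + u)\<^sup>2"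
  have "Re (csqrt ?v) \<noteq> 0"
  proof
    assume "Re (csqrt ?v) = 0"
    then have "(csqrt ?v)\<^sup>2 \<in> \<real>\<^sub>\<le>\<^sub>0"
      by (simp add: complex_nonpos_Reals_iff power2_eq_square del: power2_csqrt)
    then show False
      using quad_radicand_not_nonpos[OF u y] by simp
  qed
  then show ?thesis
    using csqrt_principal[of ?v] unfolding quad_root_def by auto
qed

lemma quad_root_plus_1_nz: "1 + quad_root y u \<noteq> 0"
  using Re_quad_root_pos by (auto simp: complex_eq_iff)

lemma norm_quad_var_less: "norm (quad_var y u) < 1"
proof -
  have "(norm (1 - quad_root y u))\<^sup>2 < (norm (1 + quad_root y u))\<^sup>2"
    unfolding cmod_power2 using Re_quad_root_pos by (simp add: power2_sum power2_diff)
  then have "norm (1 - quad_root y u) < norm (1 + quad_root y u)"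
    by (rule power_less_imp_less_base) simp
  then show ?thesis
    using quad_root_plus_1_nz by (simp add: quad_var_def norm_divide)
qed

lemma quad_var_plus_1_not_nonpos: "1 + quad_var y u \<notin> \<real>\<^sub>\<le>\<^sub>0"
  using norm_quad_var_less abs_Re_le_cmod[of "quad_var y u"] by (auto simp: complex_nonpos_Reals_iff)

lemma quad_var_eq: "4 * quad_var y u / (1 + quad_var y u)\<^sup>2 = 4 * of_real y * u / (1 + u)\<^sup>2"
proof -
  let ?q = "quad_root y u"
  have "1 + quad_var y u = 2 / (1 + ?q)"
    using quad_root_plus_1_nz by (simp add: quad_var_def field_simps)
  then have "4 * quad_var y u / (1 + quad_var y u)\<^sup>2 = (1 - ?q) * (1 + ?q)"
    using quad_root_plus_1_nz by (simp add: quad_var_def power2_eq_square)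
  also have "\<dots> = 1 - ?q\<^sup>2"
    by (simp add: power2_eq_square algebra_simps)
  finally show ?thesis
    by (simp add: quad_root_def)
qed

end

lemma one_plus_not_nonpos: "norm u < 1 \<Longrightarrow> 1 + u \<notin> \<real>\<^sub>\<le>\<^sub>0" for u :: complex
  using abs_Re_le_cmod[of u] by (auto simp: complex_nonpos_Reals_iff)

lemma one_plus_nz: "norm u < 1 \<Longrightarrow> 1 + u \<noteq> 0" for u :: complex
  by (auto simp: add_eq_0_iff)

lemma continuous_on_powr_const_complex:
  fixes f :: "'a::topological_space \<Rightarrow> complex"
  assumes "continuous_on A f" "\<And>x. x \<in> A \<Longrightarrow> f x \<notin> \<real>\<^sub>\<le>\<^sub>0"
  shows "continuous_on A (\<lambda>x. f x powr s)"
proof (rule continuous_on_compose2[OF _ assms(1), of "- \<real>\<^sub>\<le>\<^sub>0"])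
  show "continuous_on (- \<real>\<^sub>\<le>\<^sub>0) (\<lambda>z::complex. z powr s)"
    by (intro holomorphic_on_imp_continuous_on holomorphic_intros) auto
qed (use assms(2) in auto)

lemma continuous_on_quad_var:
  "continuous_on (ball 0 1 \<times> {0..1}) (\<lambda>(u, y). quad_var y u)"
proof -
  let ?A = "ball (0::complex) 1 \<times> {0..1::real}"
  have "continuous_on ?A (\<lambda>x. 1 - 4 * complex_of_real (snd x) * fst x / (1 + fst x)\<^sup>2)"
    by (intro continuous_intros) (auto simp: one_plus_nz)
  then have "continuous_on ?A (\<lambda>x. quad_root (snd x) (fst x))"
    unfolding quad_root_def
    by (rule continuous_on_compose2[OF continuous_on_csqrt]) (auto dest: quad_radicand_not_nonpos)
  then show ?thesis
    unfolding quad_var_def case_prod_beta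
    by (intro continuous_intros) (auto simp: quad_root_plus_1_nz)
qed

lemma continuous_on_gen_fun:
  assumes c: "c \<notin> \<int>\<^sub>\<le>\<^sub>0"
  shows "continuous_on (ball 0 1 \<times> {0..1}) (\<lambda>(u, y). gen_fun s c y u)"
proof -
  note q = continuous_on_quad_var[unfolded case_prod_beta]
  have 1: "continuous_on (ball 0 1 \<times> {0..1}) (\<lambda>x. (1 + fst x) powr (- s))"
    by (intro continuous_on_powr_const_complex continuous_intros) (auto dest: one_plus_not_nonpos)
  have 2: "continuous_on (ball 0 1 \<times> {0..1}) (\<lambda>x. (1 + quad_var (snd x) (fst x)) powr s)"
    by (intro continuous_on_powr_const_complex continuous_intros q) (auto dest: quad_var_plus_1_not_nonpos)
  show ?thesis
    unfolding gen_fun_def case_prod_beta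
    by (intro continuous_intros 1 2 q)
       (auto intro!: ball_subset_eball_gauss[OF c] norm_quad_var_less simp del: in_eball_iff)
qed

lemma holomorphic_on_quad_var:
  assumes y: "0 \<le> y" "y \<le> 1"
  shows "quad_var y holomorphic_on ball 0 1"
proof -
  have "quad_root y holomorphic_on ball 0 1"
    unfolding quad_root_def
    by (intro holomorphic_intros) (use quad_radicand_not_nonpos y in \<open>auto simp: one_plus_nz\<close>)
  then show ?thesis
    unfolding quad_var_def
    by (intro holomorphic_intros) (use quad_root_plus_1_nz y in auto)
qed

lemma holomorphic_on_gen_fun:
  assumes c: "c \<notin> \<int>\<^sub>\<le>\<^sub>0" and y: "0 \<le> y" "y \<le> 1"
  shows "gen_fun s c y holomorphic_on ball 0 1"
proof -
  note q = holomorphic_on_quad_var[OF y]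
  have "(\<lambda>u. eval_fps (gauss_fps s (s - c + 1) c) (quad_var y u)) holomorphic_on ball 0 1"
    by (rule holomorphic_on_compose_gen[OF q holomorphic_on_eval_fps, unfolded o_def, OF subset_refl])
       (auto intro!: ball_subset_eball_gauss[OF c] norm_quad_var_less y simp del: in_eball_iff)
  then show ?thesis
    unfolding gen_fun_def
    by (intro holomorphic_intros q) (auto simp: one_plus_not_nonpos quad_var_plus_1_not_nonpos y)
qed

text \<open>For small $u$ also $w$ is small, so the quadratic transformation, read off from the case
$y = 1$ of the generating function, applies at $w$.\<close>

lemma gen_fun_has_fps_expansion:
  assumes c: "c \<notin> \<int>\<^sub>\<le>\<^sub>0" and y: "0 \<le> y" "y \<le> 1"
  shows "gen_fun s c y has_fps_expansion Abs_fps (\<lambda>N. gen_coeff s c N (of_real y))"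
proof -
  let ?K = "\<lambda>Z. eval_fps (gauss_fps (s / 2) ((s + 1) / 2) c) Z"
  have "(\<lambda>w. (1 + w) powr (- s) * ?K (4 * 1 * w / (1 + w)\<^sup>2))
          has_fps_expansion gauss_fps s (s - c + 1) c"
    using quadratic_has_fps_expansion[OF c, of s 1] by (simp add: gen_coeff_1_gauss[OF c] fps_nth_inverse)
  then have ev: "\<forall>\<^sub>F w in nhds 0. eval_fps (gauss_fps s (s - c + 1) c) w =
      (1 + w) powr (- s) * ?K (4 * w / (1 + w)\<^sup>2)"
    by (simp add: has_fps_expansion_def)
  have "isCont (quad_var y) 0"
    using holomorphic_on_imp_continuous_on[OF holomorphic_on_quad_var[OF y]]
    by (simp add: continuous_on_eq_continuous_at)
  then have "filterlim (quad_var y) (nhds 0) (nhds 0)"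
    unfolding isCont_def tendsto_at_iff_tendsto_nhds by (simp add: quad_var_def quad_root_def)
  then have "\<forall>\<^sub>F u in nhds 0. eval_fps (gauss_fps s (s - c + 1) c) (quad_var y u) =
      (1 + quad_var y u) powr (- s) * ?K (4 * quad_var y u / (1 + quad_var y u)\<^sup>2)"
    by (rule eventually_compose_filterlim[OF ev])
  moreover have "\<forall>\<^sub>F u in nhds (0::complex). u \<in> ball 0 1"
    by (intro eventually_nhds_in_open) auto
  ultimately have "\<forall>\<^sub>F u in nhds 0. gen_fun s c y u =
      (1 + u) powr (- s) * ?K (4 * of_real y * u / (1 + u)\<^sup>2)"
  proof eventually_elim
    case (elim u)
    then have u: "norm u < 1" by simp
    have "1 + quad_var y u \<noteq> 0"
      using quad_var_plus_1_not_nonpos[OF u y] by auto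
    then show ?case
      unfolding gen_fun_def elim(1) quad_var_eq[OF u y] by (simp add: powr_minus)
  qed
  then show ?thesis
    by (rule has_fps_expansion_cong[OF _ refl, THEN iffD2])
       (rule quadratic_has_fps_expansion[OF c, of s "of_real y"])
qed

lemma gen_coeff_sums:
  assumes "c \<notin> \<int>\<^sub>\<le>\<^sub>0" "0 \<le> y" "y \<le> 1" "norm u < 1"
  shows "(\<lambda>N. gen_coeff s c N (of_real y) * u ^ N) sums gen_fun s c y u"
  using has_fps_expansion_imp_sums_complex[OF gen_fun_has_fps_expansion, of c y s 1 u]
    holomorphic_on_gen_fun[of c y s] assms by (simp add: one_ereal_def)

text \<open>Cauchy's inequality on a circle of radius $r$, together with the joint continuity of the
generating function on a compact set, bounds all the coefficients uniformly in $y$. This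
replaces the polynomial growth estimates for Jacobi polynomials and suffices for integrating
the generating series term by term.\<close>

lemma gen_coeff_bound:
  fixes s c :: complex
  assumes c: "c \<notin> \<int>\<^sub>\<le>\<^sub>0" and r: "0 < r" "r < 1"
  obtains M where "\<And>y N. 0 \<le> y \<Longrightarrow> y \<le> 1 \<Longrightarrow> norm (gen_coeff s c N (of_real y)) \<le> M / r ^ N"
proof -
  have "compact ((\<lambda>(u, y). gen_fun s c y u) ` (cball 0 r \<times> {0..1}))"
    using r by (intro compact_continuous_image continuous_on_subset[OF continuous_on_gen_fun[OF c]]
        compact_Times) auto
  then obtain M where M: "\<And>u y. norm u \<le> r \<Longrightarrow> 0 \<le> y \<Longrightarrow> y \<le> 1 \<Longrightarrow> norm (gen_fun s c y u) \<le> M"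
    by (fastforce simp: bounded_iff dest: compact_imp_bounded)
  have "norm (gen_coeff s c N (of_real y)) \<le> M / r ^ N" if y: "0 \<le> y" "y \<le> 1" for y N
  proof -
    have "norm ((deriv ^^ N) (gen_fun s c y) 0) \<le> fact N * M / r ^ N"
      using r M[of _ y] y
      by (intro Cauchy_inequality)
         (auto intro!: holomorphic_on_imp_continuous_on intro: holomorphic_on_subset[OF holomorphic_on_gen_fun[OF c y]])
    moreover have "gen_coeff s c N (of_real y) = (deriv ^^ N) (gen_fun s c y) 0 / fact N"
      using fps_nth_fps_expansion[OF gen_fun_has_fps_expansion[OF c y]] by simp
    ultimately have "norm (gen_coeff s c N (of_real y)) \<le> fact N * M / r ^ N / fact N"
      by (metis divide_right_mono fact_ge_zero norm_divide norm_fact)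
    then show ?thesis by simp
  qed
  then show ?thesis by (rule that)
qed

section \<open>Moments of Jacobi polynomials\<close>

lemma eval_gauss_terminating:
  "eval_fps (gauss_fps (- of_nat n) b c) z =
     (\<Sum>k\<le>n. pochhammer (- of_nat n) k * pochhammer b k / (pochhammer c k * fact k) * z ^ k)"
  unfolding eval_fps_def gauss_fps_nth
  by (rule suminf_finite) (auto simp: pochhammer_of_nat_eq_0_lemma)

lemma gauss_fps_commute: "gauss_fps a b c = gauss_fps b a c"
  by (rule fps_ext) (simp add: gauss_fps_nth mult_ac)

text \<open>For a terminating series the power of $1 - z$ clears the denominators on the right of Pfaff's
transformation, so both sides are polynomials and the identity extends to the whole plane.\<close>

lemma eval_gauss_terminating_Pfaff:
  fixes z :: complex
  assumes c: "c \<notin> \<int>\<^sub>\<le>\<^sub>0"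
  shows "eval_fps (gauss_fps (- of_nat n) b c) z =
     (\<Sum>i\<le>n. pochhammer (- of_nat n) i * pochhammer (c - b) i / (pochhammer c i * fact i) *
        ((- z) ^ i * (1 - z) ^ (n - i)))"
proof (rule analytic_continuation_open[where s = "ball 0 (1/2)" and s' = UNIV and
      f = "eval_fps (gauss_fps (- of_nat n) b c)" and
      g = "\<lambda>z. \<Sum>i\<le>n. pochhammer (- of_nat n) i * pochhammer (c - b) i / (pochhammer c i * fact i) *
        ((- z) ^ i * (1 - z) ^ (n - i))"])
  show "eval_fps (gauss_fps (- of_nat n) b c) holomorphic_on UNIV"
    unfolding eval_gauss_terminating by (intro holomorphic_intros)
  show "(\<lambda>z. \<Sum>i\<le>n. pochhammer (- of_nat n) i * pochhammer (c - b) i / (pochhammer c i * fact i) *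
        ((- z) ^ i * (1 - z) ^ (n - i))) holomorphic_on UNIV"
    by (intro holomorphic_intros)
  fix z :: complex assume "z \<in> ball 0 (1/2)"
  then have z: "norm (- z) < 1" "Re (- z) > - 1 / 2"
    using abs_Re_le_cmod[of z] by auto
  then have nz: "1 - z \<noteq> 0"
    by auto
  have "eval_fps (gauss_fps (- of_nat n) b c) z =
      (1 - z) ^ n * eval_fps (gauss_fps (- of_nat n) (c - b) c) (- z / (1 - z))"
    using eval_gauss_Pfaff[OF c z, of b "- of_nat n"] nz
    by (simp add: gauss_fps_commute powr_nat')
  also have "\<dots> = (\<Sum>i\<le>n. pochhammer (- of_nat n) i * pochhammer (c - b) i / (pochhammer c i * fact i) *
        ((- z) ^ i * (1 - z) ^ (n - i)))"
    unfolding eval_gauss_terminating sum_distrib_left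
  proof (intro sum.cong refl)
    fix i assume "i \<in> {..n}"
    then have "(1 - z) ^ n = (1 - z) ^ i * (1 - z) ^ (n - i)"
      by (simp flip: power_add)
    then show "(1 - z) ^ n * (pochhammer (- of_nat n) i * pochhammer (c - b) i /
          (pochhammer c i * fact i) * (- z / (1 - z)) ^ i) =
        pochhammer (- of_nat n) i * pochhammer (c - b) i / (pochhammer c i * fact i) *
          ((- z) ^ i * (1 - z) ^ (n - i))"
      unfolding power_divide using nz by simp
  qed
  finally show "eval_fps (gauss_fps (- of_nat n) b c) z = \<dots>" .
qed auto

lemma not_nonpos_Ints_of_pos: "x > 0 \<Longrightarrow> x \<notin> \<int>\<^sub>\<le>\<^sub>0" for x :: real
  by (auto elim!: nonpos_Ints_cases')

lemma of_real_not_nonpos_Ints: "x > 0 \<Longrightarrow> complex_of_real x \<notin> \<int>\<^sub>\<le>\<^sub>0"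
  by (metis not_nonpos_Ints_of_pos of_real_in_nonpos_Ints_iff)

text \<open>The Jacobi polynomial at $1 - 2y$ in the basis $y^i (1-y)^{n-i}$. In this basis each moment
of a Jacobi polynomial is a sum of Beta values that Chu--Vandermonde evaluates; the basis of
powers of $y$ would call for the Saalschuetz summation of a ${}_3F_2$ instead.\<close>

definition jacobi_bernstein :: "nat \<Rightarrow> real \<Rightarrow> real \<Rightarrow> real \<Rightarrow> real" where
  "jacobi_bernstein n \<alpha> \<beta> y =
     (\<Sum>i\<le>n. (-1) ^ i * pochhammer (\<alpha> + 1) n * pochhammer (\<beta> + real n - real i + 1) i /
        (pochhammer (\<alpha> + 1) i * fact i * fact (n - i)) * (y ^ i * (1 - y) ^ (n - i)))"

lemma jacobi_P_eq_bernstein: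
  fixes \<alpha> \<beta> y :: real
  assumes "\<alpha> > -1"
  shows "jacobi_P n (of_real \<alpha>) (of_real \<beta>) (of_real (1 - 2 * y)) =
           of_real (jacobi_bernstein n \<alpha> \<beta> y)"
proof -
  have c: "complex_of_real (\<alpha> + 1) \<notin> \<int>\<^sub>\<le>\<^sub>0"
    using assms by (intro of_real_not_nonpos_Ints) simp
  have "jacobi_P n (of_real \<alpha>) (of_real \<beta>) (of_real (1 - 2 * y)) =
      of_real (pochhammer (\<alpha> + 1) n / fact n) *
      eval_fps (gauss_fps (- of_nat n) (of_real (real n + \<alpha> + \<beta> + 1)) (of_real (\<alpha> + 1))) (of_real y)"
  proof -
    have args: "(1 - complex_of_real (1 - 2 * y)) / 2 = of_real y"
      "of_nat n + complex_of_real \<alpha> + of_real \<beta> + 1 = of_real (real n + \<alpha> + \<beta> + 1)"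
      "complex_of_real \<alpha> + 1 = of_real (\<alpha> + 1)"
      by simp_all
    show ?thesis
      unfolding jacobi_P_def hyp2F1_def args pochhammer_of_real by simp
  qed
  also have "\<dots> = of_real (pochhammer (\<alpha> + 1) n / fact n *
      (\<Sum>i\<le>n. pochhammer (- real n) i * pochhammer (- (\<beta> + real n)) i /
         (pochhammer (\<alpha> + 1) i * fact i) * ((- y) ^ i * (1 - y) ^ (n - i))))"
  proof -
    have p: "pochhammer (- of_nat n) i = (of_real (pochhammer (- real n) i) :: complex)" for i
      by (simp flip: pochhammer_of_real)
    have "complex_of_real (\<alpha> + 1) - of_real (real n + \<alpha> + \<beta> + 1) = of_real (- (\<beta> + real n))"
      by simp
    then show ?thesis
      unfolding eval_gauss_terminating_Pfaff[OF c] p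
      by (simp only: pochhammer_of_real) simp
  qed
  also have "pochhammer (\<alpha> + 1) n / fact n *
      (\<Sum>i\<le>n. pochhammer (- real n) i * pochhammer (- (\<beta> + real n)) i /
         (pochhammer (\<alpha> + 1) i * fact i) * ((- y) ^ i * (1 - y) ^ (n - i))) =
      jacobi_bernstein n \<alpha> \<beta> y"
    unfolding jacobi_bernstein_def sum_distrib_left
  proof (intro sum.cong refl)
    fix i assume "i \<in> {..n}"
    then have i: "i \<le> n" by simp
    have *: "(- y) ^ i = (-1) ^ i * y ^ i"
      by (rule power_minus)
    have "(-1) ^ i * ((-1) ^ i * ((-1) ^ i * x)) = (-1) ^ i * x" for x :: real
      by (simp flip: mult.assoc power_mult_distrib)
    then show "pochhammer (\<alpha> + 1) n / fact n * (pochhammer (- real n) i * pochhammer (- (\<beta> + real n)) i /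
         (pochhammer (\<alpha> + 1) i * fact i) * ((- y) ^ i * (1 - y) ^ (n - i))) =
       (-1) ^ i * pochhammer (\<alpha> + 1) n * pochhammer (\<beta> + real n - real i + 1) i /
        (pochhammer (\<alpha> + 1) i * fact i * fact (n - i)) * (y ^ i * (1 - y) ^ (n - i))"
      unfolding pochhammer_neg_nat_eq[OF i] pochhammer_minus[of "\<beta> + real n"] *
      by (simp add: mult_ac)
  qed
  finally show ?thesis .
qed

lemma Gamma_plus_of_nat:
  fixes x :: real
  assumes "x > 0"
  shows "Gamma (x + real n) = pochhammer x n * Gamma x"
  using pochhammer_Gamma[OF not_nonpos_Ints_of_pos[OF assms], of n] Gamma_real_pos[OF assms]
  by simp

lemma Beta_has_bochner_integral:
  fixes a b :: real
  assumes "a > 0" "b > 0"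
  shows "has_bochner_integral lborel
           (\<lambda>y. indicator {0<..<1} y * (y powr (a - 1) * (1 - y) powr (b - 1))) (Beta a b)"
proof -
  \<comment> \<open>at the endpoints the integrand vanishes since \<open>0 powr p = 0\<close>\<close>
  have eq: "indicator {0<..<1} y * (y powr (a - 1) * (1 - y) powr (b - 1)) =
      indicator {0..1} y *\<^sub>R (y powr (a - 1) * (1 - y) powr (b - 1))" for y :: real
    by (auto simp: indicator_def)
  have "(LBINT y:{0..1}. y powr (a - 1) * (1 - y) powr (b - 1)) = Beta a b"
    using set_borel_integral_eq_integral(2)[OF integrable_Beta[OF assms]]
      integral_unique[OF has_integral_Beta_real[OF assms]] by simp
  then show ?thesis
    using integrable_Beta[OF assms]
    unfolding eq has_bochner_integral_iff set_integrable_def set_lebesgue_integral_def by simp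
qed

text \<open>The factor $(-k)_n$ vanishes for $k < n$, which is the orthogonality of the Jacobi polynomial
to the polynomials of lower degree.\<close>

lemma jacobi_moment:
  fixes \<alpha> \<beta> :: real
  assumes \<alpha>: "\<alpha> > -1" and \<beta>: "\<beta> > -1"
  shows "has_bochner_integral lborel
           (\<lambda>y. indicator {0<..<1} y * (y powr \<alpha> * (1 - y) powr \<beta> * jacobi_bernstein n \<alpha> \<beta> y * y ^ k))
           (pochhammer (- real k) n / fact n * Gamma (\<alpha> + 1 + real k) * Gamma (\<beta> + real n + 1) /
              Gamma (\<alpha> + \<beta> + real k + real n + 2))"
proof -
  define C where "C i = (-1) ^ i * pochhammer (\<alpha> + 1) n * pochhammer (\<beta> + real n - real i + 1) i /
        (pochhammer (\<alpha> + 1) i * fact i * fact (n - i))" for i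
  have "has_bochner_integral lborel
      (\<lambda>y. \<Sum>i\<le>n. C i * (indicator {0<..<1} y *
         (y powr (\<alpha> + real k + real i + 1 - 1) * (1 - y) powr (\<beta> + real n - real i + 1 - 1))))
      (\<Sum>i\<le>n. C i * Beta (\<alpha> + real k + real i + 1) (\<beta> + real n - real i + 1))"
    using \<alpha> \<beta> by (intro has_bochner_integral_sum has_bochner_integral_mult_right
        Beta_has_bochner_integral) auto
  also have "(\<lambda>y. \<Sum>i\<le>n. C i * (indicator {0<..<1} y *
         (y powr (\<alpha> + real k + real i + 1 - 1) * (1 - y) powr (\<beta> + real n - real i + 1 - 1)))) =
      (\<lambda>y. indicator {0<..<1} y * (y powr \<alpha> * (1 - y) powr \<beta> * jacobi_bernstein n \<alpha> \<beta> y * y ^ k))"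
  proof
    fix y :: real
    have "y powr (\<alpha> + real k + real i + 1 - 1) * (1 - y) powr (\<beta> + real n - real i + 1 - 1) =
       y powr \<alpha> * (1 - y) powr \<beta> * (y ^ i * (1 - y) ^ (n - i)) * y ^ k"
      if y: "y \<in> {0<..<1}" and i: "i \<le> n" for i
    proof -
      have "y powr (\<alpha> + real k + real i + 1 - 1) = y powr \<alpha> * y ^ k * y ^ i"
        using y by (simp add: powr_add powr_realpow)
      moreover have "(1 - y) powr (\<beta> + real n - real i + 1 - 1) = (1 - y) powr (\<beta> + real (n - i))"
        using i by (simp add: of_nat_diff algebra_simps)
      then have "(1 - y) powr (\<beta> + real n - real i + 1 - 1) = (1 - y) powr \<beta> * (1 - y) ^ (n - i)"
        using y by (simp add: powr_add powr_realpow)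
      ultimately show ?thesis by (simp only: mult_ac)
    qed
    then show "(\<Sum>i\<le>n. C i * (indicator {0<..<1} y *
         (y powr (\<alpha> + real k + real i + 1 - 1) * (1 - y) powr (\<beta> + real n - real i + 1 - 1)))) =
      indicator {0<..<1} y * (y powr \<alpha> * (1 - y) powr \<beta> * jacobi_bernstein n \<alpha> \<beta> y * y ^ k)"
      by (cases "y \<in> {0<..<1}")
         (auto simp: jacobi_bernstein_def C_def[symmetric] sum_distrib_left sum_distrib_right
               simp del: greaterThanLessThan_iff intro!: sum.cong)
  qed
  also have "(\<Sum>i\<le>n. C i * Beta (\<alpha> + real k + real i + 1) (\<beta> + real n - real i + 1)) =
      pochhammer (- real k) n / fact n * Gamma (\<alpha> + 1 + real k) * Gamma (\<beta> + real n + 1) /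
              Gamma (\<alpha> + \<beta> + real k + real n + 2)"
  proof -
    let ?G = "Gamma (\<alpha> + 1 + real k) * Gamma (\<beta> + real n + 1) / Gamma (\<alpha> + \<beta> + real k + real n + 2)"
    have "C i * Beta (\<alpha> + real k + real i + 1) (\<beta> + real n - real i + 1) =
        pochhammer (\<alpha> + 1) n * ?G * ((-1) ^ i * pochhammer (\<alpha> + 1 + real k) i /
          (pochhammer (\<alpha> + 1) i * fact i * fact (n - i)))" if i: "i \<le> n" for i
    proof -
      have 1: "Gamma (\<alpha> + real k + real i + 1) = pochhammer (\<alpha> + 1 + real k) i * Gamma (\<alpha> + 1 + real k)"
        using Gamma_plus_of_nat[of "\<alpha> + 1 + real k" i] \<alpha> by (simp add: add_ac)
      have 2: "pochhammer (\<beta> + real n - real i + 1) i * Gamma (\<beta> + real n - real i + 1) =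
          Gamma (\<beta> + real n + 1)"
        using Gamma_plus_of_nat[of "\<beta> + real n - real i + 1" i] \<beta> i
        by (simp add: add.assoc)
      have 3: "\<alpha> + real k + real i + 1 + (\<beta> + real n - real i + 1) = \<alpha> + \<beta> + real k + real n + 2"
        by simp
      show ?thesis
        unfolding C_def Beta_def 1 3 2[symmetric] by (simp add: mult_ac)
    qed
    then have "(\<Sum>i\<le>n. C i * Beta (\<alpha> + real k + real i + 1) (\<beta> + real n - real i + 1)) =
        pochhammer (\<alpha> + 1) n * ?G * (\<Sum>i\<le>n. (-1) ^ i * pochhammer (\<alpha> + 1 + real k) i /
          (pochhammer (\<alpha> + 1) i * fact i * fact (n - i)))"
      unfolding sum_distrib_left by (intro sum.cong refl) (simp only: atMost_iff)
    also have "\<dots> = pochhammer (\<alpha> + 1) n * ?G *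
        (pochhammer (\<alpha> + 1 - (\<alpha> + 1 + real k)) n / (pochhammer (\<alpha> + 1) n * fact n))"
      by (subst Chu_Vandermonde_fact[OF not_nonpos_Ints_of_pos]) (use \<alpha> in auto)
    finally have "(\<Sum>i\<le>n. C i * Beta (\<alpha> + real k + real i + 1) (\<beta> + real n - real i + 1)) =
        pochhammer (\<alpha> + 1) n * ?G *
        (pochhammer (\<alpha> + 1 - (\<alpha> + 1 + real k)) n / (pochhammer (\<alpha> + 1) n * fact n))" .
    moreover have "pochhammer (\<alpha> + 1) n > 0"
      using \<alpha> by (intro pochhammer_pos) simp
    ultimately show ?thesis
      by (simp add: mult_ac)
  qed
  finally show ?thesis .
qed

section \<open>Integrating the generating series\<close>

text \<open>The integral of the $N$-th coefficient of the generating function against the Jacobi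
polynomial and its weight, as the corresponding combination of moments.\<close>

definition gen_coeff_integral :: "nat \<Rightarrow> real \<Rightarrow> real \<Rightarrow> real \<Rightarrow> nat \<Rightarrow> real" where
  "gen_coeff_integral n \<alpha> \<beta> s N =
     (\<Sum>k\<le>N. (-1) ^ (N + k) * pochhammer s (N + k) / (pochhammer (\<alpha> + 1) k * fact k * fact (N - k)) *
        (pochhammer (- real k) n / fact n * Gamma (\<alpha> + 1 + real k) * Gamma (\<beta> + real n + 1) /
              Gamma (\<alpha> + \<beta> + real k + real n + 2)))"

lemma gen_coeff_has_integral:
  fixes \<alpha> \<beta> :: real
  assumes "\<alpha> > -1" and "\<beta> > -1"
  shows "has_bochner_integral lborel
           (\<lambda>y. indicator {0<..<1} y *
              (y powr \<alpha> * (1 - y) powr \<beta> * jacobi_bernstein n \<alpha> \<beta> y * gen_coeff s (\<alpha> + 1) N y))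
           (gen_coeff_integral n \<alpha> \<beta> s N)"
proof -
  define C where "C k = (-1) ^ (N + k) * pochhammer s (N + k) /
    (pochhammer (\<alpha> + 1) k * fact k * fact (N - k))" for k
  let ?w = "\<lambda>y. y powr \<alpha> * (1 - y) powr \<beta> * jacobi_bernstein n \<alpha> \<beta> y"
  have "has_bochner_integral lborel
      (\<lambda>y. \<Sum>k\<le>N. C k * (indicator {0<..<1} y * (?w y * y ^ k)))
      (gen_coeff_integral n \<alpha> \<beta> s N)"
    unfolding gen_coeff_integral_def C_def[symmetric]
    by (intro has_bochner_integral_sum has_bochner_integral_mult_right jacobi_moment assms)
  also have "(\<lambda>y. \<Sum>k\<le>N. C k * (indicator {0<..<1} y * (?w y * y ^ k))) =
      (\<lambda>y. indicator {0<..<1} y * (?w y * gen_coeff s (\<alpha> + 1) N y))"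
  proof
    fix y
    have "gen_coeff s (\<alpha> + 1) N y = (\<Sum>k\<le>N. C k * y ^ k)"
      unfolding gen_coeff_def C_def by (intro sum.cong refl) simp
    then show "(\<Sum>k\<le>N. C k * (indicator {0<..<1} y * (?w y * y ^ k))) =
        indicator {0<..<1} y * (?w y * gen_coeff s (\<alpha> + 1) N y)"
      by (simp add: sum_distrib_left mult_ac)
  qed
  finally show ?thesis .
qed

lemma gen_coeff_integral_less:
  "N < n \<Longrightarrow> gen_coeff_integral n \<alpha> \<beta> s N = 0"
  unfolding gen_coeff_integral_def by (intro sum.neutral) (auto simp: pochhammer_of_nat_eq_0_lemma)

text \<open>After dropping the vanishing terms $k < n$ and shifting the index by $n$, the remaining sum is
itself a \<^const>\<open>gen_coeff\<close> at $y = 1$, with $s$ and $c$ raised to $s + 2n$ and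
$\<alpha> + \<beta> + 2n + 2$.\<close>

lemma gen_coeff_integral_ge:
  fixes n :: nat and \<alpha> \<beta> s :: real
  assumes \<alpha>: "\<alpha> > -1" and \<beta>: "\<beta> > -1"
  defines "D \<equiv> \<alpha> + \<beta> + 2 * real n + 2"
  shows "gen_coeff_integral n \<alpha> \<beta> s (n + L) =
     (-1) ^ n * Gamma (\<alpha> + 1) * Gamma (\<beta> + real n + 1) / (fact n * Gamma D) * pochhammer s (2 * n) *
     (pochhammer (s + 2 * real n) L * pochhammer (s + 2 * real n - D + 1) L / (pochhammer D L * fact L))"
proof -
  have D: "D > 0"
    using \<alpha> \<beta> by (simp add: D_def)
  let ?K = "(-1) ^ n * Gamma (\<alpha> + 1) * Gamma (\<beta> + real n + 1) / (fact n * Gamma D) * pochhammer s (2 * n)"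
  define t where "t k = (-1) ^ (n + L + k) * pochhammer s (n + L + k) /
      (pochhammer (\<alpha> + 1) k * fact k * fact (n + L - k)) *
        (pochhammer (- real k) n / fact n * Gamma (\<alpha> + 1 + real k) * Gamma (\<beta> + real n + 1) /
              Gamma (\<alpha> + \<beta> + real k + real n + 2))" for k
  have "gen_coeff_integral n \<alpha> \<beta> s (n + L) = (\<Sum>k\<le>n + L. t k)"
    by (simp add: gen_coeff_integral_def t_def)
  also have "\<dots> = (\<Sum>k\<in>{n..n + L}. t k)"
    by (intro sum.mono_neutral_right) (auto simp: t_def pochhammer_of_nat_eq_0_lemma)
  also have "\<dots> = (\<Sum>l\<le>L. t (l + n))"
    using sum.shift_bounds_cl_nat_ivl[of t 0 n L] by (simp add: atLeast0AtMost add.commute)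
  also have "\<dots> = (\<Sum>l\<le>L. ?K * ((-1) ^ (L + l) * pochhammer (s + 2 * real n) (L + l) * 1 ^ l /
        (pochhammer D l * fact l * fact (L - l))))"
  proof (intro sum.cong refl)
    fix l assume "l \<in> {..L}"
    have 1: "pochhammer (- real (l + n)) n = (-1) ^ n * fact (l + n) / fact l"
      using pochhammer_neg_nat_eq[of n "l + n", where ?'a = real] by simp
    have 2: "Gamma (\<alpha> + 1 + real (l + n)) = pochhammer (\<alpha> + 1) (l + n) * Gamma (\<alpha> + 1)"
      using \<alpha> by (intro Gamma_plus_of_nat) simp
    have "\<alpha> + \<beta> + real (l + n) + real n + 2 = D + real l"
      by (simp add: D_def)
    then have 3: "Gamma (\<alpha> + \<beta> + real (l + n) + real n + 2) = pochhammer D l * Gamma D"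
      by (simp only: Gamma_plus_of_nat[OF D])
    have index: "n + L + (l + n) = 2 * n + (L + l)" by simp
    then have 4: "pochhammer s (n + L + (l + n)) = pochhammer s (2 * n) * pochhammer (s + 2 * real n) (L + l)"
      using pochhammer_product'[of s "2 * n" "L + l"] by (simp only: of_nat_mult of_nat_numeral)
    have 5: "(-1) ^ (n + L + (l + n)) = ((-1) ^ (L + l) :: real)"
      unfolding index power_add power_mult by simp
    have 6: "n + L - (l + n) = L - l" by simp
    have "pochhammer (\<alpha> + 1) (l + n) > 0"
      using \<alpha> by (intro pochhammer_pos) simp
    then show "t (l + n) = ?K * ((-1) ^ (L + l) * pochhammer (s + 2 * real n) (L + l) * 1 ^ l /
        (pochhammer D l * fact l * fact (L - l)))"
      unfolding t_def 1 2 3 4 5 6 by (simp add: mult_ac)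
  qed
  also have "\<dots> = ?K * gen_coeff (s + 2 * real n) D L 1"
    by (simp add: gen_coeff_def sum_distrib_left)
  also have "gen_coeff (s + 2 * real n) D L 1 =
      pochhammer (s + 2 * real n) L * pochhammer (s + 2 * real n - D + 1) L / (pochhammer D L * fact L)"
    using D by (intro gen_coeff_1 not_nonpos_Ints_of_pos)
  finally show ?thesis .
qed

lemma gen_coeff_integral_sums:
  fixes n :: nat and \<alpha> \<beta> s u :: real
  assumes \<alpha>: "\<alpha> > -1" and \<beta>: "\<beta> > -1" and u: "\<bar>u\<bar> < 1"
  defines "D \<equiv> \<alpha> + \<beta> + 2 * real n + 2"
  shows "(\<lambda>N. complex_of_real (gen_coeff_integral n \<alpha> \<beta> s N) * of_real u ^ N) sums
     (of_real ((-u) ^ n * Gamma (\<alpha> + 1) * Gamma (\<beta> + real n + 1) / (fact n * Gamma D) * pochhammer s (2 * n)) *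
      eval_fps (gauss_fps (of_real (s + 2 * real n)) (of_real (s + 2 * real n - D + 1)) (of_real D)) (of_real u))"
proof -
  have D: "D > 0"
    using \<alpha> \<beta> by (simp add: D_def)
  let ?K = "complex_of_real ((-u) ^ n * Gamma (\<alpha> + 1) * Gamma (\<beta> + real n + 1) / (fact n * Gamma D) * pochhammer s (2 * n))"
  let ?F = "gauss_fps (of_real (s + 2 * real n)) (of_real (s + 2 * real n - D + 1)) (of_real D)"
  let ?t = "\<lambda>N. complex_of_real (gen_coeff_integral n \<alpha> \<beta> s N) * of_real u ^ N"
  have "complex_of_real u \<in> eball 0 (fps_conv_radius ?F)"
    by (rule ball_subset_eball_gauss[OF of_real_not_nonpos_Ints[OF D]]) (use u in simp)
  then have "ereal (norm (complex_of_real u)) < fps_conv_radius ?F"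
    by (simp only: in_eball_iff dist_0_norm)
  then have "(\<lambda>L. ?K * (fps_nth ?F L * of_real u ^ L)) sums (?K * eval_fps ?F (of_real u))"
    by (intro sums_mult sums_eval_fps)
  also have "(\<lambda>L. ?K * (fps_nth ?F L * of_real u ^ L)) = (\<lambda>L. ?t (L + n))"
  proof
    fix L
    have "(- u) ^ n = (-1) ^ n * u ^ n"
      by (rule power_minus)
    then show "?K * (fps_nth ?F L * of_real u ^ L) = ?t (L + n)"
      unfolding add.commute[of L n] gen_coeff_integral_ge[OF \<alpha> \<beta>, where n = n, folded D_def] gauss_fps_nth
      by (simp only: pochhammer_of_real power_add) (simp add: mult_ac)
  qed
  finally have "?t sums (?K * eval_fps ?F (of_real u) + (\<Sum>N<n. ?t N))"
    by (rule sums_iff_shift[THEN iffD1])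
  then show ?thesis
    by (simp add: gen_coeff_integral_less)
qed

text \<open>Termwise integration: on $[0,1]$ the series is dominated by a geometric series with ratio
$|u|/r$ for a radius $r$ between $|u|$ and $1$.\<close>

lemma gen_fun_has_integral:
  fixes n :: nat and \<alpha> \<beta> s u :: real
  assumes \<alpha>: "\<alpha> > -1" and \<beta>: "\<beta> > -1" and u: "\<bar>u\<bar> < 1"
  defines "D \<equiv> \<alpha> + \<beta> + 2 * real n + 2"
  shows "has_bochner_integral lborel
     (\<lambda>y. indicator {0<..<1} y *\<^sub>R
        (of_real (y powr \<alpha> * (1 - y) powr \<beta> * jacobi_bernstein n \<alpha> \<beta> y) *
         gen_fun (of_real s) (of_real (\<alpha> + 1)) y (of_real u)))
     (of_real ((-u) ^ n * Gamma (\<alpha> + 1) * Gamma (\<beta> + real n + 1) / (fact n * Gamma D) * pochhammer s (2 * n)) *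
      eval_fps (gauss_fps (of_real (s + 2 * real n)) (of_real (s + 2 * real n - D + 1)) (of_real D)) (of_real u))"
    (is "has_bochner_integral _ ?f ?I")
proof -
  have c: "complex_of_real (\<alpha> + 1) \<notin> \<int>\<^sub>\<le>\<^sub>0"
    using \<alpha> by (intro of_real_not_nonpos_Ints) simp
  define w where "w y = indicator {0<..<1} y * (y powr \<alpha> * (1 - y) powr \<beta> * jacobi_bernstein n \<alpha> \<beta> y)" for y
  have w: "integrable lborel w"
    using jacobi_moment[OF \<alpha> \<beta>, of n 0] by (simp add: has_bochner_integral_iff w_def[abs_def])
  define t where "t N y = complex_of_real (w y * gen_coeff s (\<alpha> + 1) N y * u ^ N)" for N y
  have w_out: "w y = 0" if "\<not> (0 < y \<and> y < 1)" for y
    using that by (auto simp: w_def indicator_def)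
  have t: "has_bochner_integral lborel (t N) (of_real (gen_coeff_integral n \<alpha> \<beta> s N) * of_real u ^ N)" for N
    using has_bochner_integral_of_real[where 'a = complex, OF has_bochner_integral_mult_left[where c = "u ^ N",
        OF gen_coeff_has_integral[OF \<alpha> \<beta>, where n = n and s = s and N = N]]]
    by (simp add: t_def[abs_def] w_def mult.assoc)
  \<comment> \<open>strictly between \<open>\<bar>u\<bar>\<close> and 1, so that the Cauchy bounds decay geometrically against \<open>u ^ N\<close>\<close>
  define r where "r = (\<bar>u\<bar> + 1) / 2"
  have r: "0 < r" "r < 1" "\<bar>u\<bar> < r"
    using u by (auto simp: r_def)
  obtain M where M: "\<And>y N. 0 \<le> y \<Longrightarrow> y \<le> 1 \<Longrightarrow>
      norm (gen_coeff (of_real s) (of_real (\<alpha> + 1)) N (of_real y) :: complex) \<le> M / r ^ N"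
    using gen_coeff_bound[OF c r(1,2)] by blast
  have bound: "norm (t N y) \<le> \<bar>w y\<bar> * (M * (\<bar>u\<bar> / r) ^ N)" for N y
  proof (cases "0 < y \<and> y < 1")
    case True
    have "\<bar>gen_coeff s (\<alpha> + 1) N y\<bar> \<le> M / r ^ N"
      using M[of y N] True unfolding gen_coeff_of_real by simp
    then have "\<bar>w y\<bar> * \<bar>gen_coeff s (\<alpha> + 1) N y\<bar> * \<bar>u\<bar> ^ N \<le> \<bar>w y\<bar> * (M / r ^ N) * \<bar>u\<bar> ^ N"
      by (intro mult_left_mono mult_right_mono) auto
    then show ?thesis
      unfolding t_def norm_of_real by (simp add: abs_mult power_abs power_divide mult.assoc)
  qed (simp add: t_def w_out)
  have geo: "summable (\<lambda>N. A * (M * (\<bar>u\<bar> / r) ^ N))" for A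
    using r by (intro summable_mult summable_geometric) simp
  have "AE y in lborel. summable (\<lambda>N. norm (t N y))"
  proof (intro AE_I2)
    show "summable (\<lambda>N. norm (t N y))" for y
      by (rule summable_comparison_test[OF _ geo[of "\<bar>w y\<bar>"]]) (use bound in auto)
  qed
  moreover have "summable (\<lambda>N. \<integral>y. norm (t N y) \<partial>lborel)"
  proof (rule summable_comparison_test[OF _ geo[of "\<integral>y. \<bar>w y\<bar> \<partial>lborel"]], intro exI allI impI)
    fix N
    have "(\<integral>y. norm (t N y) \<partial>lborel) \<le> (\<integral>y. \<bar>w y\<bar> * (M * (\<bar>u\<bar> / r) ^ N) \<partial>lborel)"
      using t[of N] w bound by (intro integral_mono) (auto simp: has_bochner_integral_iff)
    then show "norm (\<integral>y. norm (t N y) \<partial>lborel) \<le> (\<integral>y. \<bar>w y\<bar> \<partial>lborel) * (M * (\<bar>u\<bar> / r) ^ N)"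
      by simp
  qed
  moreover have ti: "integrable lborel (t N)" for N
    using t[of N] by (simp add: has_bochner_integral_iff)
  ultimately have "has_bochner_integral lborel (\<lambda>y. \<Sum>N. t N y) (\<Sum>N. integral\<^sup>L lborel (t N))"
    unfolding has_bochner_integral_iff by (intro conjI integrable_suminf integral_suminf)
  also have "(\<lambda>y. \<Sum>N. t N y) = ?f"
  proof
    fix y
    show "(\<Sum>N. t N y) = ?f y"
    proof (cases "0 < y \<and> y < 1")
      case True
      then have "(\<lambda>N. of_real (w y) * (gen_coeff (of_real s) (of_real (\<alpha> + 1)) N (of_real y) * of_real u ^ N))
          sums (of_real (w y) * gen_fun (of_real s) (of_real (\<alpha> + 1)) y (of_real u))"
        using u by (intro sums_mult gen_coeff_sums c) auto
      then have "(\<lambda>N. t N y) sums (of_real (w y) * gen_fun (of_real s) (of_real (\<alpha> + 1)) y (of_real u))"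
        unfolding gen_coeff_of_real by (simp add: t_def mult.assoc)
      then show ?thesis
        using True by (simp add: sums_iff w_def)
    qed (auto simp: t_def w_out indicator_def)
  qed
  also have "(\<Sum>N. integral\<^sup>L lborel (t N)) = ?I"
    using gen_coeff_integral_sums[OF \<alpha> \<beta> u, of n s, folded D_def] t
    by (simp add: has_bochner_integral_iff sums_iff)
  finally show ?thesis .
qed

section \<open>Ferrers functions\<close>

text \<open>Pfaff's transformation at $(1-\<zeta>)/2$ produces a Gauss series in $w = (\<zeta>-1)/(\<zeta>+1)$.
For $u = -\<rho>$ and $y = (1-x)/2$ the root \<^term>\<open>quad_root y u\<close> equals $R/(1-\<rho>) = 1/\<zeta>$, so
\<^term>\<open>quad_var y u\<close> is the same $w$ and the series is the one in the generating function.
The remaining powers combine because $1 - \<zeta>^2 = 2\<rho>(1-x)/R^2$.\<close>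

lemma ferrers_kernel_eq_gen_fun:
  fixes \<alpha> \<nu> \<rho> x R \<zeta> :: real
  assumes \<alpha>: "\<alpha> > -1" and \<rho>: "0 < \<rho>" "\<rho> < 1" and x: "-1 < x" "x < 1"
  defines "R \<equiv> sqrt (1 + \<rho>\<^sup>2 - 2 * \<rho> * x)"
  defines "\<zeta> \<equiv> (1 - \<rho>) / R"
  shows "of_real ((1 - x) powr (\<alpha> / 2) / R powr (\<nu> + 1)) * ferrers_P (of_real \<nu>) (of_real (- \<alpha>)) \<zeta> =
     of_real ((1 - x) powr \<alpha> * (\<rho> / 2) powr (\<alpha> / 2) / Gamma (\<alpha> + 1)) *
     gen_fun (of_real (\<alpha> + \<nu> + 1)) (of_real (\<alpha> + 1)) ((1 - x) / 2) (of_real (- \<rho>))"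
proof -
  define s where "s = \<alpha> + \<nu> + 1"
  define w where "w = (\<zeta> - 1) / (\<zeta> + 1)"
  define E where "E = eval_fps (gauss_fps (of_real s) (of_real (\<nu> + 1)) (of_real (\<alpha> + 1))) (complex_of_real w)"
  have radicand: "1 + \<rho>\<^sup>2 - 2 * \<rho> * x = (1 - \<rho>)\<^sup>2 + 2 * \<rho> * (1 - x)"
    by (simp add: power2_eq_square algebra_simps)
  have prod: "0 < 2 * \<rho> * (1 - x)"
    using \<rho> x by simp
  have R2: "R\<^sup>2 = (1 - \<rho>)\<^sup>2 + 2 * \<rho> * (1 - x)"
    unfolding R_def radicand using prod by (intro real_sqrt_pow2) (simp add: add_nonneg_nonneg)
  have R_gt: "1 - \<rho> < R"
    unfolding R_def radicand using prod \<rho> by (intro real_less_rsqrt) simp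
  then have R: "R > 0"
    using \<rho> by simp
  have \<zeta>: "0 < \<zeta>" "\<zeta> < 1"
    using R R_gt \<rho> by (auto simp: \<zeta>_def)
  have compl: "1 - \<zeta> = 2 * \<rho> * (1 - x) / (R\<^sup>2 * (1 + \<zeta>))"
  proof -
    have "(1 - \<zeta>) * (R\<^sup>2 * (1 + \<zeta>)) = R\<^sup>2 - (1 - \<rho>)\<^sup>2"
      using R by (simp add: \<zeta>_def power2_eq_square field_simps)
    also have "\<dots> = 2 * \<rho> * (1 - x)"
      by (simp add: R2)
    finally show ?thesis
      by (intro eq_divide_imp) (use R \<zeta> in auto)
  qed

  have root: "quad_root ((1 - x) / 2) (of_real (- \<rho>)) = of_real (R / (1 - \<rho>))"
  proof -
    have "(R / (1 - \<rho>))\<^sup>2 = 1 - 4 * ((1 - x) / 2) * (- \<rho>) / (1 + (- \<rho>))\<^sup>2"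
      using \<rho> by (simp add: power_divide R2 field_simps)
    then have "1 - 4 * of_real ((1 - x) / 2) * of_real (- \<rho>) / (1 + of_real (- \<rho>))\<^sup>2 =
        (complex_of_real (R / (1 - \<rho>)))\<^sup>2"
      by (simp only: of_real_power[symmetric]) simp
    then show ?thesis
      unfolding quad_root_def using R \<rho> by (simp add: csqrt_square del: of_real_divide of_real_diff)
  qed
  have "(1 - R / (1 - \<rho>)) / (1 + R / (1 - \<rho>)) = w"
    using R \<rho> by (simp add: w_def \<zeta>_def divide_simps)
  then have var: "quad_var ((1 - x) / 2) (of_real (- \<rho>)) = of_real w"
    unfolding quad_var_def root by (metis of_real_1 of_real_add of_real_diff of_real_divide)
  have w1: "1 + w = 2 * \<zeta> / (1 + \<zeta>)"
    using \<zeta> by (simp add: w_def field_simps)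
  have gen: "gen_fun (of_real s) (of_real (\<alpha> + 1)) ((1 - x) / 2) (of_real (- \<rho>)) =
      of_real ((1 - \<rho>) powr (- s) * (2 * \<zeta> / (1 + \<zeta>)) powr s) * E"
  proof -
    have "1 + complex_of_real (- \<rho>) = of_real (1 - \<rho>)" "1 + complex_of_real w = of_real (2 * \<zeta> / (1 + \<zeta>))"
      "complex_of_real s - of_real (\<alpha> + 1) + 1 = of_real (\<nu> + 1)"
      by (simp_all add: s_def flip: w1)
    then show ?thesis
      unfolding gen_fun_def var E_def using \<rho> \<zeta>
      by (simp add: powr_of_real del: of_real_add of_real_diff of_real_divide of_real_mult flip: of_real_minus)
         (simp add: powr_of_real)
  qed

  have hyp: "hyp2F1 (- of_real \<nu>) (of_real \<nu> + 1) (1 - of_real (- \<alpha>)) (of_real ((1 - \<zeta>) / 2)) =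
      of_real (((1 + \<zeta>) / 2) powr (- (\<nu> + 1))) * E"
  proof -
    have c: "complex_of_real (\<alpha> + 1) \<notin> \<int>\<^sub>\<le>\<^sub>0"
      using \<alpha> by (intro of_real_not_nonpos_Ints) simp
    have args: "complex_of_real ((1 - \<zeta>) / 2) = - of_real ((\<zeta> - 1) / 2)"
      "complex_of_real \<nu> + 1 = of_real (\<nu> + 1)" "1 - complex_of_real (- \<alpha>) = of_real (\<alpha> + 1)"
      by (simp_all add: field_simps)
    have "complex_of_real (\<alpha> + 1) - - of_real \<nu> = of_real s"
      by (simp add: s_def)
    moreover have "1 + complex_of_real ((\<zeta> - 1) / 2) = of_real ((1 + \<zeta>) / 2)"
      by (simp add: field_simps)
    moreover have "complex_of_real ((\<zeta> - 1) / 2) / of_real ((1 + \<zeta>) / 2) = of_real w"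
    proof -
      have "(\<zeta> - 1) / 2 / ((1 + \<zeta>) / 2) = w"
        using \<zeta> by (simp add: w_def divide_simps) (simp add: algebra_simps)
      then show ?thesis
        by (metis of_real_divide)
    qed
    ultimately have "eval_fps (gauss_fps (- of_real \<nu>) (of_real (\<nu> + 1)) (of_real (\<alpha> + 1)))
          (- of_real ((\<zeta> - 1) / 2)) =
        of_real ((1 + \<zeta>) / 2) powr (- of_real (\<nu> + 1)) * E"
      using eval_gauss_Pfaff[OF c, of "of_real ((\<zeta> - 1) / 2)" "- of_real \<nu>" "of_real (\<nu> + 1)"] \<zeta>
      unfolding E_def by (simp only: norm_of_real Re_complex_of_real) (simp add: abs_if)
    also have "of_real ((1 + \<zeta>) / 2) powr (- of_real (\<nu> + 1)) =
        complex_of_real (((1 + \<zeta>) / 2) powr (- (\<nu> + 1)))"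
      using \<zeta> powr_of_real[of "(1 + \<zeta>) / 2" "- (\<nu> + 1)"] by (simp only: of_real_minus) simp
    finally have "eval_fps (gauss_fps (- of_real \<nu>) (of_real (\<nu> + 1)) (of_real (\<alpha> + 1)))
          (- of_real ((\<zeta> - 1) / 2)) = of_real (((1 + \<zeta>) / 2) powr (- (\<nu> + 1))) * E" .
    moreover have "norm (- complex_of_real ((\<zeta> - 1) / 2)) < 1"
      unfolding norm_minus_cancel norm_of_real using \<zeta> by simp
    ultimately show ?thesis
      unfolding args by (simp only: hyp2F1_def simp_thms if_True)
  qed

  have real_eq: "(1 - x) powr (\<alpha> / 2) / R powr (\<nu> + 1) *
       (1 / Gamma (\<alpha> + 1) * ((1 + \<zeta>) / (1 - \<zeta>)) powr (- \<alpha> / 2) * ((1 + \<zeta>) / 2) powr (- (\<nu> + 1))) =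
     (1 - x) powr \<alpha> * (\<rho> / 2) powr (\<alpha> / 2) / Gamma (\<alpha> + 1) *
       ((1 - \<rho>) powr (- s) * (2 * \<zeta> / (1 + \<zeta>)) powr s)"
  proof -
    have Z: "1 + \<zeta> > 0" and X: "1 - x > 0" and P: "1 - \<rho> > 0"
      using \<zeta> x \<rho> by auto
    have quot: "(1 + \<zeta>) / (1 - \<zeta>) = (R * (1 + \<zeta>))\<^sup>2 / (2 * \<rho> * (1 - x))"
      unfolding compl using Z R X \<rho> by (simp add: power2_eq_square field_simps)
    have l1: "ln ((1 + \<zeta>) / (1 - \<zeta>)) = 2 * ln R + 2 * ln (1 + \<zeta>) - ln 2 - ln \<rho> - ln (1 - x)"
      unfolding quot using Z R X \<rho> by (simp add: ln_div ln_mult ln_realpow)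
    have l2: "ln (2 * \<zeta> / (1 + \<zeta>)) = ln 2 + ln (1 - \<rho>) - ln R - ln (1 + \<zeta>)"
      using Z R P \<zeta>(1) by (simp add: ln_div ln_mult) (simp add: \<zeta>_def ln_div)
    have l3: "ln ((1 + \<zeta>) / 2) = ln (1 + \<zeta>) - ln 2" "ln (\<rho> / 2) = ln \<rho> - ln 2"
      using Z \<rho> by (simp_all add: ln_div)
    have pw: "b powr p = exp (p * ln b)" if "b > 0" for b p :: real
      using that by (simp add: powr_def)
    have dv: "y / R powr p = y * exp (- p * ln R)" for y p
      using R by (simp add: pw exp_minus divide_inverse)
    have pos: "(1 + \<zeta>) / (1 - \<zeta>) > 0" "(1 + \<zeta>) / 2 > 0" "\<rho> / 2 > 0" "2 * \<zeta> / (1 + \<zeta>) > 0"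
      using \<zeta> \<rho> by simp_all
    have "(1 - x) powr (\<alpha> / 2) / R powr (\<nu> + 1) *
        (((1 + \<zeta>) / (1 - \<zeta>)) powr (- \<alpha> / 2) * ((1 + \<zeta>) / 2) powr (- (\<nu> + 1))) =
      exp (\<alpha> / 2 * ln (1 - x) + - (\<nu> + 1) * ln R + (- \<alpha> / 2 * ln ((1 + \<zeta>) / (1 - \<zeta>)) +
        - (\<nu> + 1) * ln ((1 + \<zeta>) / 2)))"
      by (simp only: dv pw[OF X] pw[OF pos(1)] pw[OF pos(2)] mult_exp_exp)
    also have "\<dots> = exp (\<alpha> * ln (1 - x) + \<alpha> / 2 * ln (\<rho> / 2) + (- s * ln (1 - \<rho>) +
        s * ln (2 * \<zeta> / (1 + \<zeta>))))"
      unfolding l1 l2 l3 s_def by (simp add: algebra_simps add_divide_distrib diff_divide_distrib)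
    also have "\<dots> = (1 - x) powr \<alpha> * (\<rho> / 2) powr (\<alpha> / 2) *
       ((1 - \<rho>) powr (- s) * (2 * \<zeta> / (1 + \<zeta>)) powr s)"
      by (simp only: pw[OF X] pw[OF P] pw[OF pos(3)] pw[OF pos(4)] mult_exp_exp)
    finally show ?thesis by simp
  qed

  have "ferrers_P (of_real \<nu>) (of_real (- \<alpha>)) \<zeta> =
      of_real (1 / Gamma (\<alpha> + 1) * ((1 + \<zeta>) / (1 - \<zeta>)) powr (- \<alpha> / 2) * ((1 + \<zeta>) / 2) powr (- (\<nu> + 1))) * E"
  proof -
    have "Gamma (1 - complex_of_real (- \<alpha>)) = of_real (Gamma (\<alpha> + 1))"
      by (simp add: add.commute flip: Gamma_complex_of_real)
    moreover have "complex_of_real ((1 + \<zeta>) / (1 - \<zeta>)) powr (of_real (- \<alpha>) / 2) =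
        of_real (((1 + \<zeta>) / (1 - \<zeta>)) powr (- \<alpha> / 2))"
      using \<zeta> powr_of_real[of "(1 + \<zeta>) / (1 - \<zeta>)" "- \<alpha> / 2"] by simp
    ultimately show ?thesis
      unfolding ferrers_P_def hyp by simp
  qed
  then have "of_real ((1 - x) powr (\<alpha> / 2) / R powr (\<nu> + 1)) * ferrers_P (of_real \<nu>) (of_real (- \<alpha>)) \<zeta> =
      of_real ((1 - x) powr (\<alpha> / 2) / R powr (\<nu> + 1) *
       (1 / Gamma (\<alpha> + 1) * ((1 + \<zeta>) / (1 - \<zeta>)) powr (- \<alpha> / 2) * ((1 + \<zeta>) / 2) powr (- (\<nu> + 1)))) * E"
    by (simp only: of_real_mult mult.assoc)
  then show ?thesis
    unfolding real_eq gen[unfolded s_def] by (simp only: of_real_mult mult.assoc s_def)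
qed

text \<open>At the right-hand argument $(1-\<rho>)/(1+\<rho>)$ Pfaff's transformation leads back to the Gauss
series in $-\<rho>$ that the termwise integration produces.\<close>

lemma ferrers_neg_nat_degree:
  fixes D \<rho> :: real
  assumes D: "D > 0" and \<rho>: "0 < \<rho>" "\<rho> < 1"
  shows "ferrers_P (- of_nat m) (of_real (1 - D)) ((1 - \<rho>) / (1 + \<rho>)) =
     of_real (\<rho> powr ((D - 1) / 2) * (1 + \<rho>) ^ m / Gamma D) *
     eval_fps (gauss_fps (of_real (D + real m - 1)) (of_nat m) (of_real D)) (of_real (- \<rho>))"
proof -
  have arg: "(1 - (1 - \<rho>) / (1 + \<rho>)) / 2 = \<rho> / (1 + \<rho>)"
    and quot: "(1 + (1 - \<rho>) / (1 + \<rho>)) / (1 - (1 - \<rho>) / (1 + \<rho>)) = 1 / \<rho>"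
    using \<rho> by (simp_all add: divide_simps)
  have nz: "1 + complex_of_real \<rho> \<noteq> 0"
    using \<rho> by (metis add_pos_pos less_irrefl of_real_1 of_real_add of_real_eq_0_iff zero_less_one)
  have a: "complex_of_real D - of_real (D + real m - 1) = - of_nat m + 1"
    by simp
  have "eval_fps (gauss_fps (of_real (D + real m - 1)) (of_nat m) (of_real D)) (- of_real \<rho>) =
      (1 + of_real \<rho>) powr (- of_nat m) *
      eval_fps (gauss_fps (- of_nat m + 1) (of_nat m) (of_real D)) (of_real \<rho> / (1 + of_real \<rho>))"
    unfolding a[symmetric] using \<rho> by (intro eval_gauss_Pfaff of_real_not_nonpos_Ints D) simp_all
  then have "eval_fps (gauss_fps (of_nat m) (- of_nat m + 1) (of_real D)) (of_real (\<rho> / (1 + \<rho>))) =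
      (1 + of_real \<rho>) ^ m *
      eval_fps (gauss_fps (of_real (D + real m - 1)) (of_nat m) (of_real D)) (of_real (- \<rho>))"
    using nz by (simp add: gauss_fps_commute[of "of_nat m"] powr_minus powr_nat')
  moreover have "complex_of_real (1 / \<rho>) powr (of_real (1 - D) / 2) = of_real (\<rho> powr ((D - 1) / 2))"
  proof -
    have "complex_of_real (1 / \<rho>) powr (of_real (1 - D) / 2) = of_real ((1 / \<rho>) powr ((1 - D) / 2))"
      using \<rho> powr_of_real[of "1 / \<rho>" "(1 - D) / 2"] by simp
    also have "(1 / \<rho>) powr ((1 - D) / 2) = \<rho> powr ((D - 1) / 2)"
      using \<rho> by (simp add: powr_def ln_div field_simps)
    finally show ?thesis .
  qed
  moreover have "1 - complex_of_real (1 - D) = of_real D"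
    by simp
  moreover have "hyp2F1 (- (- of_nat m)) (- of_nat m + 1) (of_real D) (of_real (\<rho> / (1 + \<rho>))) =
      eval_fps (gauss_fps (of_nat m) (- of_nat m + 1) (of_real D)) (of_real (\<rho> / (1 + \<rho>)))"
  proof -
    have "norm (complex_of_real (\<rho> / (1 + \<rho>))) < 1"
      unfolding norm_of_real using \<rho> by simp
    then show ?thesis
      by (simp only: hyp2F1_def minus_minus simp_thms if_True)
  qed
  ultimately show ?thesis
    unfolding ferrers_P_def arg quot by (simp add: Gamma_complex_of_real)
qed

theorem mainTheorem17:
  fixes m n :: nat and \<alpha> \<beta> \<rho> :: real
  assumes "\<alpha> > -1" and "\<beta> > -1"
    and "\<alpha> \<in> {-1<..<0} \<and> \<beta> \<in> {-1<..<0} \<longrightarrow> \<alpha> + \<beta> + 1 \<noteq> 0"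
    and "\<rho> \<in> {0<..<1}"
  shows
    "let R = (\<lambda>x::real. sqrt (1 + \<rho>\<^sup>2 - 2 * \<rho> * x));
         \<zeta> = (\<lambda>x::real. (1 - \<rho>) / R x);
         f = (\<lambda>x::real.
           complex_of_real
             ((1 - x) powr (\<alpha> / 2) * (1 + x) powr \<beta> / R x powr (\<beta> + real m + 1)) *
           ferrers_P (complex_of_real (\<beta> + real m)) (complex_of_real (- \<alpha>)) (\<zeta> x) *
           jacobi_P n (complex_of_real \<alpha>) (complex_of_real \<beta>) (complex_of_real x))
     in set_integrable lborel {-1<..<1} f \<and>
        (LBINT x:{-1<..<1}. f x) =
          complex_of_real
            (2 powr (\<alpha> / 2 + \<beta> + 1) * Gamma (\<beta> + real n + 1) *
             pochhammer (\<alpha> + \<beta> + real m + 1) (2 * n) /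
             (fact n * \<rho> powr ((\<beta> + 1) / 2) * (1 + \<rho>) ^ m)) *
          ferrers_P (- of_nat m) (complex_of_real (- \<alpha> - \<beta> - 2 * real n - 1))
            ((1 - \<rho>) / (1 + \<rho>))"
proof -
  have \<rho>: "0 < \<rho>" "\<rho> < 1"
    using assms(4) by auto
  define s where "s = \<alpha> + \<beta> + real m + 1"
  define D where "D = \<alpha> + \<beta> + 2 * real n + 2"
  define R where "R x = sqrt (1 + \<rho>\<^sup>2 - 2 * \<rho> * x)" for x
  define f where "f x =
      complex_of_real ((1 - x) powr (\<alpha> / 2) * (1 + x) powr \<beta> / R x powr (\<beta> + real m + 1)) *
      ferrers_P (complex_of_real (\<beta> + real m)) (complex_of_real (- \<alpha>)) ((1 - \<rho>) / R x) *
      jacobi_P n (complex_of_real \<alpha>) (complex_of_real \<beta>) (complex_of_real x)" for x :: real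
  define h where "h y = indicator {0<..<1} y *\<^sub>R
      (of_real (y powr \<alpha> * (1 - y) powr \<beta> * jacobi_bernstein n \<alpha> \<beta> y) *
       gen_fun (of_real s) (of_real (\<alpha> + 1)) y (of_real (- \<rho>)))" for y :: real
  define K where "K = 2 powr (\<alpha> + \<beta>) * (\<rho> / 2) powr (\<alpha> / 2) / Gamma (\<alpha> + 1)"
  define E where "E = eval_fps (gauss_fps (of_real (D + real m - 1)) (of_nat m) (of_real D)) (complex_of_real (- \<rho>))"
  have D: "D > 0"
    using assms(1,2) by (simp add: D_def)

  have subst: "indicator {-1<..<1} (1 + - 2 * y) *\<^sub>R f (1 + - 2 * y) = of_real K * h y" for y
  proof (cases "y \<in> {0<..<1}")
    case True
    define x where "x = 1 - 2 * y"
    have y: "y = (1 - x) / 2" and x: "-1 < x" "x < 1" and y01: "0 < y" "y < 1"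
      using True by (auto simp: x_def)
    have "f x = of_real ((1 + x) powr \<beta>) *
        (of_real ((1 - x) powr (\<alpha> / 2) / R x powr (\<beta> + real m + 1)) *
          ferrers_P (of_real (\<beta> + real m)) (of_real (- \<alpha>)) ((1 - \<rho>) / R x)) *
        of_real (jacobi_bernstein n \<alpha> \<beta> y)"
      unfolding f_def using jacobi_P_eq_bernstein[OF assms(1), of n \<beta> y] by (simp add: x_def mult_ac)
    also have "\<dots> = of_real ((1 + x) powr \<beta>) *
        (of_real ((1 - x) powr \<alpha> * (\<rho> / 2) powr (\<alpha> / 2) / Gamma (\<alpha> + 1)) *
          gen_fun (of_real s) (of_real (\<alpha> + 1)) y (of_real (- \<rho>))) *
        of_real (jacobi_bernstein n \<alpha> \<beta> y)"
      unfolding R_def ferrers_kernel_eq_gen_fun[OF assms(1) \<rho> x] y s_def by (simp only: add.assoc)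
    also have "\<dots> = of_real ((1 + x) powr \<beta> * (1 - x) powr \<alpha> * (\<rho> / 2) powr (\<alpha> / 2) / Gamma (\<alpha> + 1) *
          jacobi_bernstein n \<alpha> \<beta> y) * gen_fun (of_real s) (of_real (\<alpha> + 1)) y (of_real (- \<rho>))"
      by simp
    also have "(1 + x) powr \<beta> * (1 - x) powr \<alpha> = 2 powr (\<alpha> + \<beta>) * (y powr \<alpha> * (1 - y) powr \<beta>)"
    proof -
      have double: "1 + x = 2 * (1 - y)" "1 - x = 2 * y"
        by (simp_all add: x_def)
      show ?thesis
        using y01 unfolding double by (subst (1 2) powr_mult) (simp_all add: powr_add)
    qed
    finally have "f x = of_real K * h y"
      using True by (simp add: K_def h_def mult_ac)
    then show ?thesis
      using x by (simp add: x_def)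
  qed (auto simp: h_def indicator_def)

  define V where "V = \<rho> ^ n * Gamma (\<alpha> + 1) * Gamma (\<beta> + real n + 1) / (fact n * Gamma D) * pochhammer s (2 * n)"
  have "has_bochner_integral lborel h (of_real V * E)"
  proof -
    have "s + 2 * real n = D + real m - 1" "D + real m - 1 - D + 1 = real m"
      by (simp_all add: s_def D_def)
    then show ?thesis
      using gen_fun_has_integral[OF assms(1,2), of "- \<rho>" n s] \<rho>
      by (simp add: h_def[abs_def] E_def V_def flip: D_def)
  qed
  then have "has_bochner_integral lborel (\<lambda>y. of_real K * h y)
      (of_real K * (of_real V * E))"
    by (intro has_bochner_integral_mult_right)
  then have integrable: "set_integrable lborel {-1<..<1} f" and integral: "(LBINT x:{-1<..<1}. f x) =
      of_real (2 * K * V) * E"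
    using lborel_integrable_real_affine_iff[of "-2" "\<lambda>x. indicator {-1<..<1} x *\<^sub>R f x" 1]
      lborel_integral_real_affine[of "-2" "\<lambda>x. indicator {-1<..<1} x *\<^sub>R f x" 1]
    unfolding set_integrable_def set_lebesgue_integral_def has_bochner_integral_iff subst
    by (auto simp: scaleR_conv_of_real)
  have const: "2 * K * V =
      2 powr (\<alpha> / 2 + \<beta> + 1) * Gamma (\<beta> + real n + 1) * pochhammer s (2 * n) /
         (fact n * \<rho> powr ((\<beta> + 1) / 2) * (1 + \<rho>) ^ m) *
      (\<rho> powr ((D - 1) / 2) * (1 + \<rho>) ^ m / Gamma D)"
  proof -
    have "Gamma (\<alpha> + 1) > 0"
      using assms(1) by (intro Gamma_real_pos) simp
    then have "2 * K * V = 2 * 2 powr (\<alpha> + \<beta>) * (\<rho> / 2) powr (\<alpha> / 2) * \<rho> ^ n *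
        (Gamma (\<beta> + real n + 1) * pochhammer s (2 * n) / (fact n * Gamma D))"
      by (simp add: K_def V_def mult_ac)
    also have "2 * 2 powr (\<alpha> + \<beta>) * (\<rho> / 2) powr (\<alpha> / 2) * \<rho> ^ n =
        2 powr (\<alpha> / 2 + \<beta> + 1) * (\<rho> powr ((D - 1) / 2) / \<rho> powr ((\<beta> + 1) / 2))"
    proof -
      have "2 * 2 powr (\<alpha> + \<beta>) * (\<rho> / 2) powr (\<alpha> / 2) * \<rho> ^ n =
          2 powr (1 + (\<alpha> + \<beta>) - \<alpha> / 2) * \<rho> powr (\<alpha> / 2 + real n)"
      proof -
        have "2 powr (1 + (\<alpha> + \<beta>) - \<alpha> / 2) = 2 * 2 powr (\<alpha> + \<beta>) / 2 powr (\<alpha> / 2)"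
          unfolding powr_add[of 2 1] powr_diff by simp
        moreover have "\<rho> powr (\<alpha> / 2 + real n) = \<rho> powr (\<alpha> / 2) * \<rho> ^ n"
          using \<rho> by (simp add: powr_add powr_realpow)
        ultimately show ?thesis
          by (simp only: powr_divide) simp
      qed
      also have "1 + (\<alpha> + \<beta>) - \<alpha> / 2 = \<alpha> / 2 + \<beta> + 1"
        by simp
      also have "\<alpha> / 2 + real n = (D - 1) / 2 - (\<beta> + 1) / 2"
        by (simp add: D_def field_simps)
      finally show ?thesis
        by (simp add: powr_diff)
    qed
    finally show ?thesis
      using \<rho> by (simp add: mult_ac)
  qed
  have order: "- \<alpha> - \<beta> - 2 * real n - 1 = 1 - D"
    by (simp add: D_def)
  have "set_integrable lborel {-1<..<1} f \<and> (LBINT x:{-1<..<1}. f x) =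
      complex_of_real (2 powr (\<alpha> / 2 + \<beta> + 1) * Gamma (\<beta> + real n + 1) * pochhammer s (2 * n) /
         (fact n * \<rho> powr ((\<beta> + 1) / 2) * (1 + \<rho>) ^ m)) *
      ferrers_P (- of_nat m) (complex_of_real (- \<alpha> - \<beta> - 2 * real n - 1)) ((1 - \<rho>) / (1 + \<rho>))"
    unfolding order ferrers_neg_nat_degree[OF D \<rho>] integral const E_def[symmetric]
    using integrable by (simp only: of_real_mult mult.assoc)
  then show ?thesis
    unfolding Let_def f_def R_def s_def .
qed

end
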